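(* Let $m\ge 3$ and $r\ge 0$ be integers and $n=3m+r$. The number of permutations $\pi\in\mathfrak{S}_n$ that avoid $132$ and whose disjoint cycle decomposition consists of exactly $r$ fixed points and $m$ $3$-cycles is \[ \sum_{k=1}^m\sum_{\ell=2}^{k+1}2^{\ell-1}\binom{r+\ell-1}{r} M_{k-1,\ell-2}\sum_{(x_1,\dots,x_k) \in\mathcal{P}_{m,k}} C_{x_1}\cdots C_{x_k}, \] where $\mathcal{P}_{m,k}$ is the set of compositions of $m$ into exactly $k$ positive parts, $C_j=\frac{1}{j+1}\binom{2j}{j}$ is the $j$-th Catalan number, and $M_{k-1,\ell-2}$ is the number of Motzkin paths of length $k-1$ having exactly $\ell-2$ flat steps at height zero.
   Context: A permutation contains a pattern $\sigma$ if some subsequence of its one-line notation is in the same relative order as $\sigma$; otherwise it avoids $\sigma$. A Motzkin path of length $k$ is a lattice path from $(0,0)$ to $(k,0)$ with steps $(1,1)$, $(1,-1)$, $(1,0)$ (the last called flat steps) that never goes below the $x$-axis; a flat step is at height zero if it lies on the $x$-axis. *)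

theory Defs
  imports "HOL-Combinatorics.Permutations"
begin

text \<open>Permutations of S_n are represented as bijections p of {0..<n} (p permutes {..<n}),
  with one-line notation p 0, p 1, ..., p (n-1).\<close>

definition avoids132 :: "(nat \<Rightarrow> nat) \<Rightarrow> nat \<Rightarrow> bool" where
  "avoids132 p n \<longleftrightarrow>
     \<not> (\<exists>i j k. i < j \<and> j < k \<and> k < n \<and> p i < p k \<and> p k < p j)"

definition cycle_of :: "(nat \<Rightarrow> nat) \<Rightarrow> nat \<Rightarrow> nat set" where
  "cycle_of p i = {(p ^^ t) i | t. True}"

definition cycles_of :: "(nat \<Rightarrow> nat) \<Rightarrow> nat \<Rightarrow> nat set set" where
  "cycles_of p n = cycle_of p ` {..<n}"

definition catalan :: "nat \<Rightarrow> nat" where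
  "catalan j = (2 * j choose j) div (j + 1)"

definition compositions :: "nat \<Rightarrow> nat \<Rightarrow> nat list set" where
  "compositions m k = {xs. length xs = k \<and> (\<forall>x\<in>set xs. 0 < x) \<and> sum_list xs = m}"

text \<open>Motzkin paths as step lists: 1 = up, -1 = down, 0 = flat.\<close>
definition motzkin_path :: "int list \<Rightarrow> bool" where
  "motzkin_path s \<longleftrightarrow> set s \<subseteq> {-1, 0, 1} \<and>
     (\<forall>i \<le> length s. sum_list (take i s) \<ge> 0) \<and> sum_list s = 0"

definition flats_at_zero :: "int list \<Rightarrow> nat" where
  "flats_at_zero s = card {i. i < length s \<and> s ! i = 0 \<and> sum_list (take i s) = 0}"

definition motzkin_M :: "nat \<Rightarrow> nat \<Rightarrow> nat" where
  "motzkin_M k j = card {s. length s = k \<and> motzkin_path s \<and> flats_at_zero s = j}"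

end

theory Submission
  imports Defs "HOL-Computational_Algebra.Formal_Power_Series"
begin

text \<open>
  The permutations in question are the 132-avoiding \<open>p\<close> with \<open>p \<circ> p \<circ> p = id\<close>. If the last point
  is fixed it can be dropped, and inversion exchanges the cases \<open>p (p (N - 1)) < p (N - 1)\<close> and
  \<open>p (p (N - 1)) > p (N - 1)\<close>. In the first case, if the maximum stands at position \<open>i - 1\<close>, the
  cycles through the first \<open>i\<close> positions form a block: these positions carry the \<open>i\<close> largest values
  in the order of a 132-avoiding \<open>\<alpha>\<close> that ends with its maximum, the \<open>i\<close> largest positions carry an
  interval of consecutive values in increasing order, and the positions in that interval carry
  \<open>\<alpha>\<^sup>-\<^sup>1\<close>. Removing the block leaves a smaller permutation \<open>\<sigma>\<close> of the same kind, and the block can be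
  put back exactly at the sites of \<open>\<sigma>\<close>. Inserting at the \<open>s\<close>-th site produces a permutation with
  \<open>s + 1\<close> sites, so this is the Catalan generating tree with steps weighted by \<open>c = x C(x)\<close>. Hence, by
  number of 3-cycles, the permutations of the first kind are counted by \<open>G T\<close>, where \<open>T\<close> counts all
  of them and \<open>G = c + G\<^sup>2\<close>. Accounting for trailing fixed points gives \<open>T = (1 - 2 G)\<close> to the
  power \<open>-(r + 1)\<close>. Finally the series of Motzkin paths with \<open>j\<close> flat steps at height zero, evaluated
  at \<open>D = C(x) - 1\<close> and multiplied by \<open>D\<close>, equals \<open>G\<close> to the power \<open>j + 1\<close>, which turns the
  binomial expansion of \<open>T\<close> into the stated sum.
\<close>

unbundle fps_syntax

section \<open>Inserting a block of 3-cycles\<close>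

text \<open>
  \<open>j\<close> is a site if the \<open>j\<close> topmost points of the permutation can be separated from the others by the
  middle part of an inserted block without creating the pattern 132.
\<close>
definition sites :: "nat \<Rightarrow> (nat \<Rightarrow> nat) \<Rightarrow> nat set" where
  "sites N p = {j. 2 * j \<le> N \<and> (\<forall>x<j. N - j \<le> p x) \<and>
     (\<forall>x y. N - j \<le> x \<longrightarrow> x < y \<longrightarrow> y < N \<longrightarrow> p x < p y)}"

text \<open>The cube condition says that all cycles have length 1 or 3; counting moved points then
  replaces counting 3-cycles.\<close>

definition tri_perms :: "nat \<Rightarrow> nat \<Rightarrow> (nat \<Rightarrow> nat) set" where
  "tri_perms N m = {p. p permutes {..<N} \<and> avoids132 p N \<and> (\<forall>x. p (p (p x)) = x) \<and>
     card {x. p x \<noteq> x} = 3 * m}"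

definition av132 :: "nat \<Rightarrow> (nat \<Rightarrow> nat) set" where
  "av132 n = {p. p permutes {..<n} \<and> avoids132 p n}"

section \<open>Basic facts on 132-avoidance, top values and sites\<close>

lemma avoids132D:
  "\<lbrakk>avoids132 p n; x < y; y < z; z < n; p x < p z\<rbrakk> \<Longrightarrow> p y \<le> p z"
  unfolding avoids132_def by (meson not_le)

lemma permutes_lessThan_iff: "p permutes {..<n} \<Longrightarrow> p x < n \<longleftrightarrow> x < n" for n :: nat
  using permutes_in_image[of p "{..<n}" x] by simp

lemma permutes_if_cube_id:
  assumes "\<And>x. p (p (p x)) = x" "\<And>x. x \<notin> S \<Longrightarrow> p x = x"
  shows "p permutes S"
  unfolding permutes_def using assms by metis

text \<open>The first \<open>k\<close> positions map injectively into the \<open>k\<close> largest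
  values, hence onto them, which leaves none of these values for later positions.\<close>

lemma top_values_iff:
  fixes N :: nat
  assumes p: "p permutes {..<N}" and k: "k \<le> N" and top: "\<forall>x<k. N - k \<le> p x" and x: "x < N"
  shows "N - k \<le> p x \<longleftrightarrow> x < k"
proof -
  have inj: "inj p" using p by (rule permutes_inj)
  have "p ` {..<k} \<subseteq> {N - k..<N}"
    using top k permutes_lessThan_iff[OF p] by auto
  moreover have "card (p ` {..<k}) = k"
    using inj by (simp add: card_image inj_on_subset)
  ultimately have "p ` {..<k} = {N - k..<N}"
    using k by (intro card_subset_eq) auto
  then show ?thesis
    using x permutes_lessThan_iff[OF p] inj
    by (metis (no_types, lifting) atLeastLessThan_iff image_iff injD lessThan_iff)
qed

text \<open>The \<open>N - k\<close> distinct values at the positions from \<open>k\<close> on all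
  lie below \<open>p x\<close>.\<close>

lemma left_above_right_imp_top:
  fixes N :: nat
  assumes p: "p permutes {..<N}" and h: "\<And>z. k \<le> z \<Longrightarrow> z < N \<Longrightarrow> p z < p x"
  shows "N - k \<le> p x"
proof -
  have "p ` {k..<N} \<subseteq> {..<p x}" using h by auto
  then have "card (p ` {k..<N}) \<le> p x"
    using card_mono[of "{..<p x}"] by fastforce
  moreover have "card (p ` {k..<N}) = N - k"
    using permutes_inj[OF p] by (simp add: card_image inj_on_subset)
  ultimately show ?thesis by simp
qed

lemma down_closed_eq_lessThan:
  fixes Y :: "nat set"
  assumes "finite Y" "\<And>x y. y \<in> Y \<Longrightarrow> x < y \<Longrightarrow> x \<in> Y"
  shows "Y = {..<card Y}"
proof (cases "Y = {}")
  case False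
  have "Y = {..Max Y}"
  proof
    show "Y \<subseteq> {..Max Y}" using assms(1) by auto
    show "{..Max Y} \<subseteq> Y"
      using assms(2)[of "Max Y"] Max_in[OF assms(1) False] by (metis atMost_iff nat_less_le subsetI)
  qed
  then have "Y = {..<Suc (Max Y)}" by (simp add: lessThan_Suc_atMost)
  then show ?thesis by (metis card_lessThan)
qed simp

lemma zero_in_sites [simp]: "0 \<in> sites N p"
  by (auto simp: sites_def)

lemma finite_sites [simp]: "finite (sites N p)"
  by (rule finite_subset[of _ "{..N}"]) (auto simp: sites_def)

lemma card_sites_le: "card (sites N p) \<le> Suc N"
  using card_mono[of "{..N}" "sites N p"] by (force simp: sites_def)

text \<open>The pattern 132 is its own inverse: exchanging positions and values turns an occurrence
  in \<open>inv p\<close> into one in \<open>p\<close>.\<close>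

lemma avoids132_inv:
  assumes p: "p permutes {..<n}" and a: "avoids132 p n"
  shows "avoids132 (inv p) n"
  unfolding avoids132_def
proof (intro notI, elim exE conjE)
  fix x y z assume h: "x < y" "y < z" "z < n" "inv p x < inv p z" "inv p z < inv p y"
  have "inv p y < n" using h permutes_lessThan_iff[OF permutes_inv[OF p]] by simp
  with avoids132D[OF a, of "inv p x" "inv p z" "inv p y"] h
  show False by (simp add: permutes_inverses[OF p])
qed

text \<open>
  \<open>L\<close> is the size of \<open>\<sigma>\<close>. The ground set is laid out, from left to right, as the first part of the
  block (\<open>i\<close> points), the \<open>L - j\<close> low points of \<open>\<sigma>\<close>, the middle part of the block, the \<open>j\<close> top points
  of \<open>\<sigma>\<close>, and the last part of the block; \<open>e\<close> embeds the points of \<open>\<sigma>\<close>.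
\<close>
definition insert_block :: "nat \<Rightarrow> nat \<Rightarrow> nat \<Rightarrow> (nat \<Rightarrow> nat) \<Rightarrow> (nat \<Rightarrow> nat) \<Rightarrow> nat \<Rightarrow> nat" where
  "insert_block L i j \<alpha> \<sigma> x = (let K = L - j; e = (\<lambda>z. if z < K then z + i else z + 2 * i) in
     if x < i then L + 2 * i + \<alpha> x
     else if x < K + i then e (\<sigma> (x - i))
     else if x < K + 2 * i then inv \<alpha> (x - K - i)
     else if x < L + 2 * i then e (\<sigma> (x - 2 * i))
     else if x < L + 3 * i then x - (L + 2 * i) + K + i
     else x)"

text \<open>\<open>\<alpha>_last\<close> puts the overall maximum at position \<open>i - 1\<close>,
  so that \<open>i\<close> can be recovered from the result.\<close>

locale block_insertion =
  fixes L i j :: nat and \<alpha> \<sigma> :: "nat \<Rightarrow> nat"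
  assumes i_pos: "0 < i" and \<alpha>_perm: "\<alpha> permutes {..<i}" and \<alpha>_av: "avoids132 \<alpha> i"
    and \<alpha>_last: "\<alpha> (i - 1) = i - 1"
    and \<sigma>_perm: "\<sigma> permutes {..<L}" and \<sigma>_av: "avoids132 \<sigma> L"
    and \<sigma>_cube: "\<And>x. \<sigma> (\<sigma> (\<sigma> x)) = x" and j_site: "j \<in> sites L \<sigma>"
begin

definition "K = L - j"
definition "e z = (if z < K then z + i else z + 2 * i)"
definition "p = insert_block L i j \<alpha> \<sigma>"

lemma j_le: "2 * j \<le> L" and KL: "K + j = L"
  using j_site by (auto simp: sites_def K_def)

lemma \<alpha>_less [simp]: "\<alpha> x < i \<longleftrightarrow> x < i"
  using permutes_lessThan_iff[OF \<alpha>_perm] .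

lemma \<sigma>_less [simp]: "\<sigma> x < L \<longleftrightarrow> x < L"
  using permutes_lessThan_iff[OF \<sigma>_perm] .

lemma p_low: "x < i \<Longrightarrow> p x = L + 2 * i + \<alpha> x"
  by (simp add: p_def insert_block_def)

lemma p_high: "y < i \<Longrightarrow> p (L + 2 * i + y) = K + i + y"
  using KL by (auto simp: p_def insert_block_def K_def Let_def)

lemma p_mid: "x < i \<Longrightarrow> p (K + i + \<alpha> x) = x"
  using KL by (simp add: p_def insert_block_def K_def[symmetric] Let_def permutes_inverses[OF \<alpha>_perm])

lemma p_e: "x < L \<Longrightarrow> p (e x) = e (\<sigma> x)"
  using KL by (auto simp: p_def insert_block_def K_def[symmetric] Let_def e_def)

lemma p_out: "L + 3 * i \<le> x \<Longrightarrow> p x = x"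
  using KL by (auto simp: p_def insert_block_def K_def[symmetric] Let_def)

text \<open>The middle part is parametrised by \<open>\<alpha> y\<close> so that
  \<open>p_mid\<close> applies without \<open>inv \<alpha>\<close>.\<close>

lemma region_cases:
  assumes "x < L + 3 * i"
  obtains (low) "x < i" | (high) y where "y < i" "x = L + 2 * i + y"
    | (mid) y where "y < i" "x = K + i + \<alpha> y" | (rest) y where "y < L" "x = e y"
proof -
  consider "x < i" | "i \<le> x" "x < K + i" | "K + i \<le> x" "x < K + 2 * i"
    | "K + 2 * i \<le> x" "x < L + 2 * i" | "L + 2 * i \<le> x" by linarith
  then show thesis
  proof cases
    case 2
    then show thesis using KL by (intro rest[of "x - i"]) (auto simp: e_def)
  next
    case 3
    have "\<alpha> (inv \<alpha> (x - (K + i))) = x - (K + i)"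
      by (simp add: permutes_inverses[OF \<alpha>_perm])
    with 3 show thesis
      using permutes_lessThan_iff[OF permutes_inv[OF \<alpha>_perm]]
      by (intro mid[of "inv \<alpha> (x - (K + i))"]) auto
  next
    case 4
    then show thesis using KL by (intro rest[of "x - 2 * i"]) (auto simp: e_def)
  next
    case 5
    then show thesis using assms by (intro high[of "x - (L + 2 * i)"]) auto
  qed (use low in blast)
qed

text \<open>The block consists of the cycles \<open>x\<close>,
  \<open>L + 2 * i + \<alpha> x\<close>, \<open>K + i + \<alpha> x\<close> for \<open>x < i\<close>;
  elsewhere \<open>e\<close> transports the cycles of \<open>\<sigma>\<close>.\<close>

lemma p_cube: "p (p (p x)) = x"
proof (cases "x < L + 3 * i")
  case True
  then show ?thesis
  proof (cases rule: region_cases)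
    case low
    then show ?thesis by (simp add: p_low p_high p_mid)
  next
    case (high y)
    define z where "z = inv \<alpha> y"
    have z: "y = \<alpha> z" by (simp add: z_def permutes_inverses[OF \<alpha>_perm])
    with high show ?thesis by (simp add: p_low p_high p_mid)
  next
    case (mid y)
    then show ?thesis by (simp add: p_low p_high p_mid)
  next
    case (rest y)
    then show ?thesis by (simp add: p_e \<sigma>_cube)
  qed
qed (simp add: p_out)

lemma p_perm: "p permutes {..<L + 3 * i}"
  by (rule permutes_if_cube_id) (auto simp: p_cube p_out)

lemma e_less_iff [simp]: "e x < e y \<longleftrightarrow> x < y"
  by (auto simp: e_def)

lemma e_eq_iff [simp]: "e x = e y \<longleftrightarrow> x = y"
  by (auto simp: e_def)

lemma e_bounds: "i \<le> e x" "x < L \<Longrightarrow> e x < L + 2 * i"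
  by (auto simp: e_def)

lemma top_\<sigma>: "x < L \<Longrightarrow> K \<le> \<sigma> x \<longleftrightarrow> x < j"
  using top_values_iff[OF \<sigma>_perm, of j x] j_site j_le by (auto simp: sites_def K_def)

lemma moved_p: "card {x. p x \<noteq> x} = card {x. \<sigma> x \<noteq> x} + 3 * i"
proof -
  let ?M = "{x. \<sigma> x \<noteq> x}"
  have M: "?M \<subseteq> {..<L}" using permutes_not_in[OF \<sigma>_perm] by auto
  have "{x. p x \<noteq> x} = e ` ?M \<union> {..<i} \<union> {K + i..<K + 2 * i} \<union> {L + 2 * i..<L + 3 * i}" (is "?A = ?B")
  proof (intro equalityI subsetI)
    fix x assume "x \<in> ?A"
    then have px: "p x \<noteq> x" by simp
    then have "x < L + 3 * i" using p_out by (meson not_le)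
    then show "x \<in> ?B"
    proof (cases rule: region_cases)
      case (rest y)
      then show ?thesis using px p_e[of y] by auto
    qed auto
  next
    fix x assume x: "x \<in> ?B"
    then have "x < L + 3 * i" using M e_bounds KL by fastforce
    then show "x \<in> ?A"
    proof (cases rule: region_cases)
      case low
      then show ?thesis by (simp add: p_low)
    next
      case (high y)
      then show ?thesis using KL by (simp add: p_high)
    next
      case (mid y)
      then show ?thesis by (simp add: p_mid)
    next
      case (rest y)
      moreover have "x \<in> e ` ?M" using x rest KL by (auto simp: e_def split: if_splits)
      ultimately show ?thesis by (auto simp: p_e)
    qed
  qed
  moreover have "card (e ` ?M) = card ?M" by (simp add: card_image inj_on_def)
  moreover have "finite ?M" using M finite_subset by blast
  moreover have "(e ` ?M) \<inter> {..<i} = {}" by (auto simp: e_def)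
  moreover have "(e ` ?M) \<inter> {K + i..<K + 2 * i} = {}" by (auto simp: e_def)
  moreover have "(e ` ?M) \<inter> {L + 2 * i..<L + 3 * i} = {}" using M e_bounds(2) by fastforce
  ultimately show ?thesis using KL
    by (subst \<open>?A = ?B\<close>, subst card_Un_disjoint, simp, simp, fastforce,
        subst card_Un_disjoint, simp, simp, fastforce,
        subst card_Un_disjoint) auto
qed

text \<open>Right of the middle part there are no descents, so the 3 and the 2 of a pattern cannot
  both lie there. In the mixed case, the points of \<open>\<sigma>\<close> there do not carry its
  top values, so they stay below the interval carried by the last part.\<close>

lemma p_increasing:
  assumes "K + 2 * i \<le> x" "x < y" "y < L + 3 * i"
  shows "p x < p y"
proof -
  consider "y < L + 2 * i" | "x < L + 2 * i" "L + 2 * i \<le> y" | "L + 2 * i \<le> x" by linarith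
  then show ?thesis
  proof cases
    case 1
    have "e (x - 2 * i) = x" "e (y - 2 * i) = y" using assms by (auto simp: e_def)
    moreover have "\<sigma> (x - 2 * i) < \<sigma> (y - 2 * i)"
      using j_site assms 1 KL by (auto simp: sites_def)
    ultimately show ?thesis using p_e[of "x - 2 * i"] p_e[of "y - 2 * i"] 1 assms by simp
  next
    case 2
    have "e (x - 2 * i) = x" using assms by (auto simp: e_def)
    moreover have "\<not> x - 2 * i < j" "x - 2 * i < L" using 2 assms KL j_le by auto
    ultimately have "p x < K + i"
      using top_\<sigma>[of "x - 2 * i"] p_e[of "x - 2 * i"] by (auto simp: e_def)
    moreover have "K + i \<le> p y"
      using p_high[of "y - (L + 2 * i)"] assms 2 by auto
    ultimately show ?thesis by simp
  next
    case 3
    then show ?thesis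
      using p_high[of "x - (L + 2 * i)"] p_high[of "y - (L + 2 * i)"] assms by auto
  qed
qed

text \<open>The cases follow the region of the smallest entry \<open>x\<close>. A pattern starting
  in the first or middle part lies wholly in that part and yields one in \<open>\<alpha>\<close>.
  One starting in \<open>\<sigma>\<close> either stays there or ends in the last part, and the site
  condition excludes the latter.\<close>

lemma p_av: "avoids132 p (L + 3 * i)"
  unfolding avoids132_def
proof (intro notI, elim exE conjE)
  fix x y z assume h: "x < y" "y < z" "z < L + 3 * i" "p x < p z" "p z < p y"
  have lowval: "w < K + 2 * i \<and> K + i \<le> w" if "p w < i" "w < L + 3 * i" for w
    using that(2)
  proof (cases rule: region_cases)
    case (rest y)
    then show ?thesis using that e_bounds(1)[of "\<sigma> y"] by (simp add: p_e)
  qed (use that in \<open>auto simp: p_low p_high\<close>)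
  have topval: "w < i" if "L + 2 * i \<le> p w" "w < L + 3 * i" for w
    using that(2)
  proof (cases rule: region_cases)
    case (rest y)
    then show ?thesis using that e_bounds(2)[of "\<sigma> y"] by (simp add: p_e)
  qed (use that KL in \<open>auto simp: p_high p_mid\<close>)
  have xlt: "x < L + 3 * i" and ylt: "y < L + 3 * i" using h by auto
  from xlt show False
  proof (cases rule: region_cases)
    case low
    then have "z < i" "y < i" using h topval[of z] topval[of y] by (auto simp: p_low)
    then show False using h low avoids132D[OF \<alpha>_av, of x y z] by (simp add: p_low)
  next
    case (high w)
    then show False using h KL p_increasing[of y z] by simp
  next
    case (mid w)
    \<comment> \<open>Beyond the middle part the values increase, so the descent from
      \<open>y\<close> to \<open>z\<close> must begin inside it.\<close>
    have "y < K + 2 * i" using h p_increasing[of y z] by (meson not_le order.asym)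
    then have y: "y = K + i + (y - (K + i))" "y - (K + i) < i" using mid h by auto
    define y' where "y' = inv \<alpha> (y - (K + i))"
    have y': "y = K + i + \<alpha> y'" "y' < i"
      using y permutes_lessThan_iff[OF permutes_inv[OF \<alpha>_perm]]
      by (auto simp: y'_def permutes_inverses[OF \<alpha>_perm])
    then have "p z < i" using h by (simp add: p_mid)
    then have z: "z < K + 2 * i" "K + i \<le> z" using lowval h by auto
    define z' where "z' = inv \<alpha> (z - (K + i))"
    have z': "z = K + i + \<alpha> z'" "z' < i"
      using z permutes_lessThan_iff[OF permutes_inv[OF \<alpha>_perm]]
      by (auto simp: z'_def permutes_inverses[OF \<alpha>_perm])
    \<comment> \<open>The middle part carries the inverse of \<open>\<alpha>\<close>, so positions
      and values trade places and \<open>z'\<close> comes before \<open>y'\<close>.\<close>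
    have "w < z'" "z' < y'" "\<alpha> w < \<alpha> y'" "\<alpha> y' < \<alpha> z'"
      using h mid y' z' by (auto simp: p_mid)
    then show False using avoids132D[OF \<alpha>_av, of w z' y'] y' by simp
  next
    case (rest w)
    have px: "p x = e (\<sigma> w)" using rest by (simp add: p_e)
    have xi: "i \<le> p x" "i \<le> x" using px rest e_bounds by auto
    from ylt show False
    proof (cases rule: region_cases)
      case low
      then show False using xi h by simp
    next
      case (high y')
      then show False using h KL p_increasing[of y z] by simp
    next
      case (mid y')
      then show False using xi h by (simp add: p_mid)
    next
      case y: (rest y')
      have py: "p y = e (\<sigma> y')" using y by (simp add: p_e)
      from h(3) show False
      proof (cases rule: region_cases)
        case low
        then show False using xi h by simp
      next
        case (mid z')
        then show False using xi h by (simp add: p_mid)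
      next
        case z: (rest z')
        then show False using h y py rest px avoids132D[OF \<sigma>_av, of w y' z']
          by (auto simp: p_e)
      next
        case (high z')
        then have pz: "p z = K + i + z'" by (simp add: p_high)
        \<comment> \<open>The value \<open>p z\<close> lies in the gap that \<open>e\<close> leaves
          between low and top values of \<open>\<sigma>\<close>. Since the top values occupy the
          first \<open>j\<close> positions, \<open>y\<close> would precede \<open>x\<close>.\<close>
        then have "K \<le> \<sigma> y'" "\<sigma> w < K"
          using h high py px by (auto simp: e_def split: if_splits)
        then have "y' < j" "\<not> w < j" using top_\<sigma> rest y by (auto simp: not_le[symmetric])
        then have "e y' < e w" by simp
        then show False using h y rest by simp
      qed
    qed
  qed
qed

lemma p_last: "p (L + 3 * i - 1) = K + 2 * i - 1"
proof -
  have "L + 2 * i + (i - 1) = L + 3 * i - 1" "K + i + (i - 1) = K + 2 * i - 1" using i_pos by auto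
  then show ?thesis using p_high[of "i - 1"] i_pos by simp
qed

lemma p_max: "p (i - 1) = L + 3 * i - 1"
  using p_low[of "i - 1"] i_pos \<alpha>_last by simp

text \<open>A nonzero site must take in position \<open>i - 1\<close> of the maximum, hence the
  whole first part, and its size is bounded through the value at the last point. What remains of it
  is a site of \<open>\<sigma>\<close> not exceeding \<open>j\<close>.\<close>

lemma sites_p: "sites (L + 3 * i) p = insert 0 ((+) i ` {v \<in> sites L \<sigma>. v \<le> j})"
proof (intro equalityI subsetI)
  fix k assume k: "k \<in> sites (L + 3 * i) p"
  show "k \<in> insert 0 ((+) i ` {v \<in> sites L \<sigma>. v \<le> j})"
  proof (cases "k = 0")
    case False
    have k2: "2 * k \<le> L + 3 * i" using k by (simp add: sites_def)
    have top: "L + 3 * i - k \<le> p x \<longleftrightarrow> x < k" if "x < L + 3 * i" for x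
      using top_values_iff[OF p_perm, of k x] k that by (auto simp: sites_def)
    have "L + 3 * i - k \<le> p (i - 1)" unfolding p_max using False by simp
    moreover have "i - 1 < L + 3 * i" using i_pos by simp
    ultimately have "i \<le> k" using top[of "i - 1"] by simp
    then obtain v where v: "k = i + v" using le_Suc_ex by blast
    \<comment> \<open>The last point is not among the first \<open>k\<close>, so its value
      \<open>K + 2 * i - 1\<close> is not among the \<open>k\<close> largest; this forces
      \<open>v \<le> j\<close>.\<close>
    have "\<not> L + 3 * i - 1 < k" using k2 False i_pos by auto
    then have "K + 2 * i - 1 < L + 3 * i - k"
      using top[of "L + 3 * i - 1", unfolded p_last] i_pos by auto
    then have vj: "v \<le> j" using v KL by auto
    have "L - v \<le> \<sigma> x" if x: "x < v" for x
    proof -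
      have "x < K" "x < L" using x vj j_le KL by auto
      then have "e x = x + i" "e (\<sigma> x) = p (x + i)" using p_e[of x] by (auto simp: e_def)
      moreover have "L + 3 * i - k \<le> p (x + i)" using top[of "x + i"] x v k2 by auto
      ultimately have "L + 2 * i - v \<le> e (\<sigma> x)" using v by simp
      then show ?thesis using vj KL i_pos by (auto simp: e_def split: if_splits)
    qed
    then have "v \<in> sites L \<sigma>" using j_site vj by (auto simp: sites_def)
    then show ?thesis using v vj by blast
  qed simp
next
  fix k assume "k \<in> insert 0 ((+) i ` {v \<in> sites L \<sigma>. v \<le> j})"
  then consider "k = 0" | v where "k = i + v" "v \<in> sites L \<sigma>" "v \<le> j" by auto
  then show "k \<in> sites (L + 3 * i) p"
  proof cases
    case 2
    have "L + 3 * i - k \<le> p x" if "x < k" for x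
    proof (cases "x < i")
      case True
      then show ?thesis using 2 by (simp add: p_low)
    next
      case False
      define y where "y = x - i"
      have y: "x = y + i" "y < v" using that 2 False by (auto simp: y_def)
      then have "y < K" "y < L" using 2 j_le KL by auto
      then have "p x = e (\<sigma> y)" using y p_e[of y] by (simp add: e_def)
      moreover have "L - v \<le> \<sigma> y" using 2 y by (auto simp: sites_def)
      ultimately show ?thesis using 2 KL by (auto simp: e_def)
    qed
    moreover have "p x < p y" if "L + 3 * i - k \<le> x" "x < y" "y < L + 3 * i" for x y
      using that 2 KL by (intro p_increasing) auto
    ultimately show ?thesis using 2 j_le by (auto simp: sites_def)
  qed simp
qed

end

section \<open>Removing a block\<close>

text \<open>Assumption \<open>A\<close> says that the maximum stands left of the position
  \<open>b\<close> that equals the last value. Avoidance then forces the three parts of the block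
  one after another, and the complement of the block is closed under \<open>p\<close>.\<close>

lemma block_decomposition:
  assumes perm: "p permutes {..<N}" and pav: "avoids132 p N" and cube: "\<And>x. p (p (p x)) = x"
    and A: "p (p (N - 1)) < p (N - 1)"
  obtains L i j \<alpha> \<sigma> where "block_insertion L i j \<alpha> \<sigma>" "N = L + 3 * i" "p = insert_block L i j \<alpha> \<sigma>"
proof -
  have inj: "p x = p y \<longleftrightarrow> x = y" for x y using permutes_inj[OF perm] by (auto dest: injD)
  have lessN [simp]: "p x < N \<longleftrightarrow> x < N" for x using permutes_lessThan_iff[OF perm] .
  \<comment> \<open>Because \<open>p\<close> has order dividing 3, \<open>u\<close> is the position
    of the maximum.\<close>
  define b where "b = p (N - 1)"
  define u where "u = p b"
  define i where "i = Suc u"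
  have pu: "p u = N - 1" unfolding u_def b_def by (rule cube)
  have ub: "u < b" using A by (simp add: u_def b_def)
  have N: "0 < N"
  proof (rule ccontr)
    assume "\<not> 0 < N"
    then have "p = id" using perm by simp
    then show False using A by simp
  qed
  have "b < N" using N by (simp add: b_def)
  moreover have "b \<noteq> N - 1" using ub pu inj[of u "N - 1"] by (auto simp: b_def)
  ultimately have bN: "b < N - 1" by simp
  have "u < N" using ub bN by simp
  have out: "x \<ge> N \<Longrightarrow> p x = x" for x using permutes_not_in[OF perm] by simp

  \<comment> \<open>With the maximum as the 3, avoidance puts every value before it above every
    value after it.\<close>
  have top: "N - i \<le> p x" if "x < i" for x
  proof (rule left_above_right_imp_top[OF perm])
    fix z assume z: "i \<le> z" "z < N"
    have "p z < N" using z by simp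
    moreover have "p z \<noteq> N - 1" using z inj[of z u] pu by (simp add: i_def)
    ultimately have "p z < N - 1" by linarith
    show "p z < p x"
    proof (cases "x = u")
      case True
      then show ?thesis using pu \<open>p z < N - 1\<close> by simp
    next
      case False
      have "\<not> p x < p z"
        using avoids132D[OF pav, of x u z] False that z pu \<open>p z < N - 1\<close> by (auto simp: i_def)
      moreover have "p x \<noteq> p z" using that z by (simp add: inj)
      ultimately show ?thesis by simp
    qed
  qed
  have iN: "i \<le> N" using ub bN by (simp add: i_def)
  have topiff: "N - i \<le> p x \<longleftrightarrow> x < i" if "x < N" for x
    using top_values_iff[OF perm iN _ that] top by blast

  \<comment> \<open>There are \<open>k\<close> values above \<open>b\<close>. With the last point as
    the 2, avoidance forces them into the first \<open>k\<close> positions.\<close>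
  define k where "k = N - 1 - b"
  have Y: "b < p x \<longleftrightarrow> x < k" if "x < N" for x
  proof -
    define Y where "Y = {x. x < N \<and> b < p x}"
    have "Y = {..<card Y}"
    proof (rule down_closed_eq_lessThan)
      show "finite Y" by (simp add: Y_def)
      fix x y assume y: "y \<in> Y" and xy: "x < y"
      have "y < N" "y \<noteq> N - 1" using y by (auto simp: Y_def b_def)
      then have yN: "y < N - 1" by linarith
      have "\<not> p x < b"
        using avoids132D[OF pav xy yN] N y by (auto simp: Y_def b_def)
      moreover have "p x \<noteq> b" using xy yN inj[of x "N - 1"] by (simp add: b_def)
      ultimately show "x \<in> Y" using xy yN by (auto simp: Y_def)
    qed
    moreover have "card Y = k"
    proof -
      have "p ` Y = {b<..<N}"
      proof
        show "p ` Y \<subseteq> {b<..<N}" by (auto simp: Y_def)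
        show "{b<..<N} \<subseteq> p ` Y"
        proof
          fix v assume "v \<in> {b<..<N}"
          then show "v \<in> p ` Y" by (intro image_eqI[of _ _ "p (p v)"]) (auto simp: Y_def cube)
        qed
      qed
      moreover have "card (p ` Y) = card Y" by (simp add: card_image inj_on_def inj)
      ultimately show ?thesis by (simp add: k_def)
    qed
    ultimately have "Y = {..<k}" by simp
    then show ?thesis using that by (auto simp: Y_def)
  qed
  have ik: "i \<le> k" using Y[of u] pu bN ub \<open>u < N\<close> by (simp add: i_def)
  have kb: "k \<le> b" using Y[of b] ub \<open>b < N\<close> by (simp add: u_def)

  \<comment> \<open>If \<open>p x \<le> u\<close>, then \<open>p (p x)\<close> is one of the
    \<open>i\<close> largest points and so at least \<open>k\<close>; by \<open>Y\<close> its image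
    \<open>x\<close> cannot exceed \<open>b\<close>.\<close>
  have right: "u < p x" if x: "b < x" "x < N" for x
  proof (rule ccontr)
    assume "\<not> u < p x"
    then have "p x < i" by (simp add: i_def)
    then have "N - i \<le> p (p x)" by (rule top)
    then have "k \<le> p (p x)" using ik kb bN by (simp add: k_def)
    then have "\<not> b < p (p (p x))" using Y[of "p (p x)"] x by simp
    then show False using x cube by simp
  qed
  \<comment> \<open>The value \<open>u\<close> at position \<open>b\<close> is below everything to
    its right, so a descent there would complete a 132.\<close>
  have incr: "p x < p y" if "b < x" "x < y" "y < N" for x y
  proof -
    have "p b < p y" using right[of y] that by (simp add: u_def)
    then have "p x \<le> p y" using avoids132D[OF pav that] by simp
    then show ?thesis using that inj[of x y] by simp
  qed

  \<comment> \<open>\<open>s\<close> lists the values at the last \<open>i\<close> positions. They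
    increase up to \<open>b\<close>; that they are consecutive needs another use of
    avoidance.\<close>
  define s where "s y = p (N - i + y)" for y
  have s_low: "p (s y) < i" if "y < i" for y
  proof -
    have "N - i + y < N" using that iN by simp
    then show ?thesis using topiff[of "p (p (N - i + y))"] by (simp add: s_def cube)
  qed
  have bi: "b < N - i" using ik bN by (simp add: k_def)
  have s_mono: "s y < s (Suc y)" if "Suc y < i" for y
    unfolding s_def using incr[of "N - i + y" "N - i + Suc y"] bi that iN by simp
  have s_mono2: "s y < s z" if "y < z" "z < i" for y z
    unfolding s_def using incr[of "N - i + y" "N - i + z"] bi that iN by simp
  have s_last: "s u = b" unfolding s_def b_def i_def using iN by (simp add: i_def)
  have s_Suc: "s (Suc y) = Suc (s y)" if y: "Suc y < i" for y
  proof (rule ccontr)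
    assume "s (Suc y) \<noteq> Suc (s y)"
    then have v: "s y < Suc (s y)" "Suc (s y) < s (Suc y)" using s_mono[OF y] by auto
    define v where "v = Suc (s y)"
    have "s (Suc y) \<le> b" using s_mono2[of "Suc y" u] y s_last by (cases "Suc y = u") (auto simp: i_def)
    then have vb: "v < b" using v by (simp add: v_def)
    \<comment> \<open>A skipped \<open>v\<close> is no value of \<open>s\<close>, so it is not
      mapped below \<open>i\<close>. Then the positions \<open>s y\<close>, \<open>v\<close>,
      \<open>b\<close> form a 132, with \<open>u\<close> at \<open>b\<close> as the 2.\<close>
    have "\<not> p v < i"
    proof
      assume "p v < i"
      then have "N - i \<le> p (p v)" by (rule top)
      define z where "z = p (p v) - (N - i)"
      have "v < N" using vb bN by simp
      then have "p (p v) < N" by simp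
      with \<open>N - i \<le> p (p v)\<close> iN have "z < i" unfolding z_def by linarith
      moreover have "v = s z"
        using \<open>N - i \<le> p (p v)\<close> unfolding s_def z_def by (simp add: cube)
      ultimately have z: "v = s z" "z < i" by auto
      then have "y < z" using v s_mono2[of z y] y by (cases z y rule: linorder_cases) (auto simp: v_def)
      moreover have "z < Suc y" using z v s_mono2[of "Suc y" z]
        by (cases z "Suc y" rule: linorder_cases) (auto simp: v_def)
      ultimately show False by simp
    qed
    moreover have "p (s y) < i" using s_low y by simp
    moreover have "p (s y) \<noteq> u"
      using inj[of "s y" b] vb v by (auto simp: u_def v_def)
    ultimately have "p (s y) < p b" "p b < p v" by (auto simp: u_def i_def)
    then show False using avoids132D[OF pav, of "s y" v b] vb \<open>b < N\<close> v by (simp add: v_def)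
  qed
  have s_eq: "y < i \<Longrightarrow> s y = s 0 + y" for y
    by (induction y) (auto simp: s_Suc)
  have s0: "i \<le> s 0" unfolding s_def using right[of "N - i"] bi by (simp add: i_def)
  define K where "K = s 0 - i"
  have bK: "b = K + i + u" using s_eq[of u] s_last s0 by (simp add: K_def i_def)
  define L where "L = N - 3 * i"
  define j where "j = L - K"
  have NL: "N = L + 3 * i" and KL: "K \<le> L" using bK bi by (auto simp: L_def i_def)
  have LK: "L - j = K" using KL by (simp add: j_def)
  have kj: "k = i + j" using bK NL KL by (simp add: k_def j_def i_def)

  have p_high: "p (L + 2 * i + y) = K + i + y" if "y < i" for y
  proof -
    have "N - i = L + 2 * i" using NL by simp
    then show ?thesis using s_eq[OF that] s0 by (simp add: s_def K_def)
  qed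
  have low_ge: "L + 2 * i \<le> p x" "p x < L + 3 * i" if "x < i" for x
    using top[OF that] NL lessN[of x] that iN by auto
  have p_mid: "p (K + i + (p x - (L + 2 * i))) = x" if "x < i" for x
    using p_high[of "p x - (L + 2 * i)"] low_ge[OF that] cube[of x] by simp
  \<comment> \<open>The point \<open>s 0 = K + i\<close> has a value below \<open>i\<close>, so it
    is not among the first \<open>k = i + j\<close> positions.\<close>
  have jK: "j \<le> K"
  proof -
    have "\<not> b < p (s 0)" using s_low[of 0] ub by (simp add: i_def)
    moreover have "N - i < N" using NL by (simp add: i_def)
    then have "s 0 < N" by (simp add: s_def)
    ultimately show ?thesis using Y[of "s 0"] s0 kj by (simp add: K_def)
  qed

  \<comment> \<open>\<open>B\<close> is the block. Closure under \<open>p\<close> lets the remaining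
    points be relabelled by \<open>e\<close> and its inverse \<open>d\<close> to give
    \<open>\<sigma>\<close>.\<close>
  define B where "B = {..<i} \<union> {K + i..<K + 2 * i} \<union> {L + 2 * i..<L + 3 * i}"
  have pB: "p x \<in> B" if "x \<in> B" for x
  proof -
    consider "x < i" | "L + 2 * i \<le> x" "x < L + 3 * i" | "K + i \<le> x" "x < K + 2 * i"
      using \<open>x \<in> B\<close> unfolding B_def by auto
    then show ?thesis
    proof cases
      case 1
      then show ?thesis using low_ge by (simp add: B_def)
    next
      case 2
      then have "x = L + 2 * i + (x - (L + 2 * i))" "x - (L + 2 * i) < i" by auto
      then obtain y where "x = L + 2 * i + y" "y < i" by blast
      then show ?thesis using p_high[of y] by (simp add: B_def)
    next
      case 3
      then have "s (x - (K + i)) = x" using s_eq[of "x - (K + i)"] s0 by (simp add: K_def)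
      then show ?thesis using s_low[of "x - (K + i)"] 3 by (simp add: B_def)
    qed
  qed
  have pB_iff: "p x \<in> B \<longleftrightarrow> x \<in> B" for x using pB cube by metis

  define e where "e z = (if z < K then z + i else z + 2 * i)" for z
  define d where "d y = (if y < K + i then y - i else y - 2 * i)" for y
  have de [simp]: "d (e z) = z" for z by (auto simp: d_def e_def)
  have e_rest: "e z < N \<and> e z \<notin> B" if "z < L" for z
    using that KL NL by (auto simp: e_def B_def)
  have ed: "e (d y) = y \<and> d y < L" if "y < N" "y \<notin> B" for y
    using that KL NL by (auto simp: e_def d_def B_def)
  have e_less [simp]: "e x < e y \<longleftrightarrow> x < y" for x y by (auto simp: e_def)

  define \<alpha> where "\<alpha> x = (if x < i then p x - (L + 2 * i) else x)" for x
  define \<sigma> where "\<sigma> x = (if x < L then d (p (e x)) else x)" for x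
  have \<alpha>_less: "\<alpha> x < i" if "x < i" for x using low_ge[OF that] that by (simp add: \<alpha>_def)
  have p_\<alpha>: "p x = L + 2 * i + \<alpha> x" if "x < i" for x using low_ge[OF that] that by (simp add: \<alpha>_def)
  have \<alpha>_perm: "\<alpha> permutes {..<i}"
  proof (rule bij_imp_permutes)
    have "inj_on \<alpha> {..<i}" by (rule inj_onI) (metis lessThan_iff p_\<alpha> inj)
    moreover have "\<alpha> ` {..<i} \<subseteq> {..<i}" using \<alpha>_less by auto
    ultimately show "bij_betw \<alpha> {..<i} {..<i}" by (simp add: bij_betw_def endo_inj_surj)
  qed (simp add: \<alpha>_def)
  have \<alpha>_av: "avoids132 \<alpha> i"
    unfolding avoids132_def
  proof (intro notI, elim exE conjE)
    fix x y z assume h: "x < y" "y < z" "z < i" "\<alpha> x < \<alpha> z" "\<alpha> z < \<alpha> y"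
    then show False using avoids132D[OF pav, of x y z] iN by (simp add: p_\<alpha>)
  qed
  have \<alpha>_last: "\<alpha> (i - 1) = i - 1" using pu NL by (simp add: \<alpha>_def i_def)
  have e\<sigma>: "e (\<sigma> x) = p (e x) \<and> \<sigma> x < L" if "x < L" for x
    using ed[of "p (e x)"] e_rest[OF that] that pB_iff by (simp add: \<sigma>_def)
  have \<sigma>_cube: "\<sigma> (\<sigma> (\<sigma> x)) = x" for x
  proof (cases "x < L")
    case True
    then have "e (\<sigma> (\<sigma> (\<sigma> x))) = e x" using e\<sigma> cube by simp
    then show ?thesis using de by metis
  qed (simp add: \<sigma>_def)
  have \<sigma>_perm: "\<sigma> permutes {..<L}" by (rule permutes_if_cube_id) (simp_all add: \<sigma>_cube, simp add: \<sigma>_def)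
  have \<sigma>_av: "avoids132 \<sigma> L"
    unfolding avoids132_def
  proof (intro notI, elim exE conjE)
    fix x y z assume h: "x < y" "y < z" "z < L" "\<sigma> x < \<sigma> z" "\<sigma> z < \<sigma> y"
    then have "e x < e y" "e y < e z" "e z < N" "p (e x) < p (e z)" "p (e z) < p (e y)"
      using e_rest e\<sigma>[of x, THEN conjunct1, symmetric] e\<sigma>[of y, THEN conjunct1, symmetric]
        e\<sigma>[of z, THEN conjunct1, symmetric] by auto
    then show False using avoids132D[OF pav] by (meson not_le)
  qed
  \<comment> \<open>The first \<open>j\<close> points of \<open>\<sigma>\<close> land among the
    first \<open>k\<close> positions, whose values exceed \<open>b\<close>, the end of the middle
    part; its last \<open>j\<close> points land right of \<open>b\<close>, where \<open>p\<close>
    increases.\<close>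
  have j_site: "j \<in> sites L \<sigma>"
  proof -
    have "L - j \<le> \<sigma> x" if "x < j" for x
    proof -
      have "x < K" "x < L" using that jK KL by auto
      then have "e x = x + i" by (simp add: e_def)
      then have "b < p (e x)" using Y[of "x + i"] that kj \<open>x < L\<close> NL by simp
      then have "b < e (\<sigma> x)" using e\<sigma>[OF \<open>x < L\<close>] by simp
      then show ?thesis unfolding LK using bK by (auto simp: e_def i_def split: if_splits)
    qed
    moreover have "\<sigma> x < \<sigma> y" if "L - j \<le> x" "x < y" "y < L" for x y
    proof -
      have "b < e x" using that LK bK by (auto simp: e_def i_def)
      moreover have "e y < N" using that e_rest by simp
      ultimately have "p (e x) < p (e y)" using incr that by simp
      then have "e (\<sigma> x) < e (\<sigma> y)" using e\<sigma>[of x] e\<sigma>[of y] that by simp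
      then show ?thesis by simp
    qed
    ultimately show ?thesis using jK LK KL by (auto simp: sites_def j_def)
  qed
  have "0 < i" by (simp add: i_def)
  have bl: "block_insertion L i j \<alpha> \<sigma>"
    by unfold_locales (use \<open>0 < i\<close> \<alpha>_perm \<alpha>_av \<alpha>_last \<sigma>_perm \<sigma>_av \<sigma>_cube j_site in auto)
  interpret I: block_insertion L i j \<alpha> \<sigma> by (rule bl)
  have IK: "I.K = K" by (simp add: I.K_def LK)
  have Ie: "I.e = e" by (intro ext) (simp add: I.e_def e_def IK)
  have "I.p x = p x" for x
  proof (cases "x < L + 3 * i")
    case True
    then show ?thesis
    proof (cases rule: I.region_cases)
      case low
      then show ?thesis by (simp add: I.p_low p_\<alpha>)
    next
      case (high y)
      then show ?thesis by (simp add: I.p_high p_high IK)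
    next
      case (mid y)
      then show ?thesis using p_mid[of y] I.p_mid[of y] by (simp add: IK p_\<alpha>)
    next
      case (rest y)
      then show ?thesis using e\<sigma>[of y] I.p_e[of y] by (simp add: Ie)
    qed
  next
    case False
    then show ?thesis using I.p_out out NL by simp
  qed
  then have "p = insert_block L i j \<alpha> \<sigma>" by (auto simp: I.p_def)
  with bl NL show thesis by (intro that)
qed

section \<open>Catalan numbers and Motzkin paths\<close>

text \<open>Writing the central binomial coefficient as \<open>n + 1\<close> times a difference of
  neighbouring ones shows that the natural number division in \<open>catalan\<close> is
  exact.\<close>

lemma Suc_mult_catalan: "(n + 1) * catalan n = 2 * n choose n"
proof -
  have "n * (2 * n choose n) = Suc n * (2 * n choose Suc n)"
    using binomial_absorb_comp[of "2 * n" n] binomial_absorption[of n "2 * n"] by simp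
  then have "(2 * n choose n) = (n + 1) * ((2 * n choose n) - (2 * n choose Suc n))"
    by (simp add: diff_mult_distrib2)
  then have "(n + 1) dvd (2 * n choose n)" by (rule dvdI)
  then show ?thesis unfolding catalan_def by (rule dvd_mult_div_cancel)
qed

lemma catalan_Suc_mult: "(n + 2) * catalan (Suc n) = (4 * n + 2) * catalan n"
proof -
  have a: "Suc n * (2 * Suc n choose Suc n) = 2 * Suc n * (2 * n + 1 choose n)"
    using binomial_absorption[of n "2 * Suc n"] by simp
  have b: "Suc n * (2 * n + 1 choose n) = (2 * n + 1) * (2 * n choose n)"
    using binomial_absorb_comp[of "2 * n + 1" n] by simp
  have "Suc n * ((n + 2) * catalan (Suc n)) = Suc n * (2 * Suc n choose Suc n)"
    using Suc_mult_catalan[of "Suc n"] by simp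
  also have "\<dots> = 2 * ((2 * n + 1) * (2 * n choose n))" using a b by (simp only: mult.assoc)
  also have "\<dots> = Suc n * ((4 * n + 2) * catalan n)"
    unfolding Suc_mult_catalan[symmetric] by (simp add: algebra_simps)
  finally show ?thesis by (simp only: mult_cancel1) simp
qed

text \<open>The coefficients of \<open>sqrt (1 - 4 x)\<close>.\<close>
lemma half_gchoose_Suc_eq_catalan:
  "((1 / 2 :: rat) gchoose Suc n) * (- 4) ^ Suc n = - 2 * of_nat (catalan n)"
proof (induction n)
  case 0
  then show ?case by (simp add: catalan_def)
next
  case (Suc n)
  define a :: rat where "a = 1 / 2 gchoose Suc n"
  define b :: rat where "b = 1 / 2 gchoose Suc (Suc n)"
  define P :: rat where "P = (- 4) ^ Suc n"
  define N :: rat where "N = of_nat n"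
  have ab: "1 / 2 * a = (N + 1) * a + (N + 2) * b"
    using gbinomial_mult_1[of "1 / 2 :: rat" "Suc n"] by (simp add: a_def b_def N_def add.commute)
  have IH: "a * P = - 2 * of_nat (catalan n)" using Suc by (simp add: a_def P_def)
  have "rat_of_nat ((n + 2) * catalan (Suc n)) = of_nat ((4 * n + 2) * catalan n)"
    by (simp only: catalan_Suc_mult)
  then have C: "(N + 2) * of_nat (catalan (Suc n)) = (4 * N + 2) * of_nat (catalan n)"
    by (simp add: N_def algebra_simps)
  have "(N + 2) * b = - (N + 1 / 2) * a" using ab by (simp add: algebra_simps)
  then have "(N + 2) * b * (- 4 * P) = - (N + 1 / 2) * a * (- 4 * P)" by (simp only:)
  also have "\<dots> = (4 * N + 2) * (a * P)" by (simp add: algebra_simps)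
  also have "\<dots> = - 2 * ((4 * N + 2) * of_nat (catalan n))" unfolding IH by simp
  also have "\<dots> = (N + 2) * (- 2 * of_nat (catalan (Suc n)))" unfolding C[symmetric] by simp
  finally have "(N + 2) * (b * (- 4 * P)) = (N + 2) * (- 2 * of_nat (catalan (Suc n)))"
    by (simp only: mult.assoc)
  moreover have "N + 2 \<noteq> 0" using of_nat_0_le_iff[of n, where ?'a = rat] unfolding N_def by linarith
  ultimately have "b * (- 4 * P) = - 2 * of_nat (catalan (Suc n))"
    using mult_left_cancel[of "N + 2"] by blast
  then show ?case by (simp only: b_def P_def power_Suc)
qed

definition catalan_fps :: "rat fps" where
  "catalan_fps = Abs_fps (\<lambda>n. of_nat (catalan n))"

text \<open>The series \<open>c\<close>. Its coefficient at \<open>i\<close> will count the choices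
  of \<open>\<alpha>\<close> for a block whose parts have size \<open>i\<close>.\<close>

definition xcat_fps :: "rat fps" where "xcat_fps = fps_X * catalan_fps"

lemma xcat_fps_nth_0 [simp]: "xcat_fps $ 0 = 0"
  by (simp add: xcat_fps_def)

text \<open>The binomial series \<open>s\<close> of the square root of \<open>1 - 4 x\<close> equals
  \<open>1 - 2 c\<close>, and Vandermonde's identity with \<open>1 / 2 + 1 / 2 = 1\<close> squares
  it.\<close>

lemma xcat_fps_quadratic: "xcat_fps = fps_X + xcat_fps * xcat_fps"
proof -
  define s :: "rat fps" where "s = Abs_fps (\<lambda>n. (1 / 2 gchoose n) * (- 4) ^ n)"
  have "s $ n = (1 - 2 * xcat_fps) $ n" for n
    by (cases n) (use half_gchoose_Suc_eq_catalan in
        \<open>simp_all add: s_def xcat_fps_def catalan_fps_def numeral_fps_const\<close>)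
  then have s: "s = 1 - 2 * xcat_fps" by (simp add: fps_eq_iff)
  have "(s * s) $ n = (1 - 4 * fps_X) $ n" for n
  proof -
    have "(s * s) $ n = (\<Sum>k=0..n. ((1 / 2 gchoose k) * (1 / 2 gchoose (n - k))) * (- 4) ^ n)"
      unfolding fps_mult_nth s_def
      by (rule sum.cong) (simp_all add: mult_ac power_add[symmetric])
    also have "\<dots> = (1 gchoose n) * (- 4) ^ n"
      using gbinomial_Vandermonde[of "1 / 2 :: rat" "1 / 2" n] by (simp add: sum_distrib_right[symmetric])
    also have "(1 gchoose n :: rat) = of_nat (1 choose n)" by (simp add: binomial_gbinomial)
    also have "of_nat (1 choose n) * (- 4) ^ n = (1 - 4 * fps_X :: rat fps) $ n"
      by (cases n; cases "n - 1") (auto simp: numeral_fps_const binomial_eq_0)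
    finally show ?thesis .
  qed
  then have "s * s = 1 - 4 * fps_X" by (simp add: fps_eq_iff)
  then have "4 * (fps_X + xcat_fps * xcat_fps) = 4 * xcat_fps" unfolding s by (simp add: algebra_simps)
  then have "fps_X + xcat_fps * xcat_fps = xcat_fps" by (simp only: mult_cancel_left) simp
  then show ?thesis by (rule sym)
qed

lemma catalan_fps_inverse: "catalan_fps * (1 - xcat_fps) = 1"
proof -
  have "fps_X * (catalan_fps * (1 - xcat_fps)) = xcat_fps - xcat_fps * xcat_fps"
    by (simp add: xcat_fps_def algebra_simps)
  also have "\<dots> = fps_X * 1" using xcat_fps_quadratic[symmetric] by (simp add: diff_eq_eq)
  finally have "fps_X * (catalan_fps * (1 - xcat_fps)) = fps_X * 1" .
  then show ?thesis by (simp only: mult_cancel_left) simp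
qed

lemma catalan_Suc: "catalan (Suc n) = (\<Sum>i=0..n. catalan i * catalan (n - i))"
proof -
  have "catalan_fps = 1 + fps_X * (catalan_fps * catalan_fps)"
    using catalan_fps_inverse by (simp add: xcat_fps_def algebra_simps)
  then have "catalan_fps $ Suc n = (1 + fps_X * (catalan_fps * catalan_fps)) $ Suc n" by (rule arg_cong)
  then have "catalan_fps $ Suc n = (catalan_fps * catalan_fps) $ n" by simp
  then have "rat_of_nat (catalan (Suc n)) = of_nat (\<Sum>i=0..n. catalan i * catalan (n - i))"
    by (simp add: fps_mult_nth catalan_fps_def)
  then show ?thesis by (simp only: of_nat_eq_iff)
qed

text \<open>The series \<open>G\<close>. Substituting \<open>c\<close> for \<open>x\<close> in
  \<open>c = x + c^2\<close> gives \<open>G = c + G^2\<close>.\<close>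

definition layer_fps :: "rat fps" where "layer_fps = xcat_fps oo xcat_fps"

lemma layer_fps_nth_0 [simp]: "layer_fps $ 0 = 0"
  by (simp add: layer_fps_def)

lemma layer_fps_quadratic: "layer_fps = xcat_fps + layer_fps * layer_fps"
proof -
  have "(fps_X + xcat_fps * xcat_fps) oo xcat_fps = xcat_fps + (xcat_fps oo xcat_fps) * (xcat_fps oo xcat_fps)"
    by (simp add: fps_compose_add_distrib fps_compose_mult_distrib)
  then show ?thesis by (simp only: layer_fps_def xcat_fps_quadratic[symmetric])
qed

lemma xcat_fps_eq: "xcat_fps = layer_fps - layer_fps * layer_fps"
  using layer_fps_quadratic[symmetric] by (simp add: eq_diff_eq)

text \<open>The series \<open>D\<close>. The constant term is removed because the parts of a
  composition are positive.\<close>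

definition cat_pos_fps :: "rat fps" where "cat_pos_fps = catalan_fps - 1"

lemma cat_pos_fps_nth_0 [simp]: "cat_pos_fps $ 0 = 0"
  by (simp add: cat_pos_fps_def catalan_fps_def catalan_def)

text \<open>This is \<open>D (1 - c) = c\<close> with \<open>c = G - G^2\<close> substituted, the
  only relation between \<open>D\<close> and \<open>G\<close> needed for the Motzkin series.\<close>

lemma cat_pos_fps_layer_fps: "cat_pos_fps * (1 - layer_fps + layer_fps * layer_fps) = layer_fps - layer_fps * layer_fps"
proof -
  have "cat_pos_fps * (1 - xcat_fps) = xcat_fps"
    using catalan_fps_inverse by (simp add: cat_pos_fps_def algebra_simps)
  then show ?thesis unfolding xcat_fps_eq by (simp add: algebra_simps)
qed

section \<open>Compositions with Catalan weights\<close>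

lemma compositions_Suc:
  "compositions m (Suc k) = (\<lambda>(x, xs). x # xs) ` (SIGMA x:{1..m}. compositions (m - x) k)"
  (is "?A = ?B")
proof (intro equalityI subsetI)
  fix ys assume "ys \<in> ?A"
  then obtain x xs where "ys = x # xs" "length xs = k" "0 < x" "\<forall>y\<in>set xs. 0 < y" "x + sum_list xs = m"
    by (cases ys) (auto simp: compositions_def)
  then show "ys \<in> ?B" by (intro image_eqI[of _ _ "(x, xs)"]) (auto simp: compositions_def)
qed (auto simp: compositions_def)

lemma compositions_0: "compositions m 0 = (if m = 0 then {[]} else {})"
  by (auto simp: compositions_def)

lemma finite_compositions: "finite (compositions m k)"
  by (induction k arbitrary: m) (auto simp: compositions_0 compositions_Suc)

text \<open>Splitting off the first part yields a Cauchy product with \<open>D\<close>, whose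
  vanishing constant term accounts for the missing part 0.\<close>

lemma sum_compositions_catalan:
  "of_nat (\<Sum>xs\<in>compositions m k. prod_list (map catalan xs)) = (cat_pos_fps ^ k) $ m"
proof (induction k arbitrary: m)
  case 0
  then show ?case by (simp add: compositions_0)
next
  case (Suc k)
  have inj: "inj_on (\<lambda>(x, xs). x # xs) A" for A :: "('x \<times> 'x list) set" by (auto simp: inj_on_def)
  have "(\<Sum>xs\<in>compositions m (Suc k). prod_list (map catalan xs)) =
      (\<Sum>(x, xs)\<in>(SIGMA x:{1..m}. compositions (m - x) k). catalan x * prod_list (map catalan xs))"
    unfolding compositions_Suc sum.reindex[OF inj] by (rule sum.cong) auto
  also have "\<dots> = (\<Sum>x=1..m. catalan x * (\<Sum>xs\<in>compositions (m - x) k. prod_list (map catalan xs)))"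
    by (simp add: sum.Sigma[symmetric] finite_compositions sum_distrib_left)
  finally have "rat_of_nat (\<Sum>xs\<in>compositions m (Suc k). prod_list (map catalan xs)) =
      (\<Sum>x=1..m. of_nat (catalan x) * (cat_pos_fps ^ k) $ (m - x))"
    using Suc by simp
  also have "\<dots> = (\<Sum>x=1..m. cat_pos_fps $ x * (cat_pos_fps ^ k) $ (m - x))"
    by (rule sum.cong) (auto simp: cat_pos_fps_def catalan_fps_def)
  also have "\<dots> = (\<Sum>x=0..m. cat_pos_fps $ x * (cat_pos_fps ^ k) $ (m - x))"
    by (rule sum.mono_neutral_left) (auto simp: not_le Suc_le_eq)
  finally show ?case by (simp add: fps_mult_nth)
qed

section \<open>Motzkin paths from an arbitrary starting height\<close>

text \<open>With the starting height as a parameter, removing the first step stays within the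
  family.\<close>

fun motzkin_from :: "int \<Rightarrow> int list \<Rightarrow> bool" where
  "motzkin_from h [] \<longleftrightarrow> h = 0"
| "motzkin_from h (a # s) \<longleftrightarrow> a \<in> {-1, 0, 1} \<and> 0 \<le> h + a \<and> motzkin_from (h + a) s"

fun flats_from :: "int \<Rightarrow> int list \<Rightarrow> nat" where
  "flats_from h [] = 0"
| "flats_from h (a # s) = (if a = 0 \<and> h = 0 then 1 else 0) + flats_from (h + a) s"

lemma all_le_Suc_iff: "(\<forall>i\<le>Suc n. P i) \<longleftrightarrow> P 0 \<and> (\<forall>i\<le>n. P (Suc i))"
  by (metis Suc_le_mono bot_nat_0.extremum not0_implies_Suc)

text \<open>The recursion tests the height only after each step; \<open>0 \<le> h\<close> supplies
  the empty prefix.\<close>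

lemma motzkin_from_iff:
  "0 \<le> h \<Longrightarrow> motzkin_from h s \<longleftrightarrow> set s \<subseteq> {-1, 0, 1} \<and>
     (\<forall>i\<le>length s. 0 \<le> h + sum_list (take i s)) \<and> h + sum_list s = 0"
proof (induction s arbitrary: h)
  case (Cons a s)
  show ?case
  proof (cases "0 \<le> h + a")
    case True
    show ?thesis
      unfolding motzkin_from.simps Cons.IH[OF True] list.size(4) add_0_right One_nat_def add_Suc_right
        all_le_Suc_iff
      using Cons.prems True by (auto simp: add.assoc)
  next
    case False
    have "\<exists>i\<le>length (a # s). \<not> 0 \<le> h + sum_list (take i (a # s))"
      using False by (intro exI[of _ 1]) auto
    then show ?thesis using False by auto
  qed
qed auto

lemma flats_from_eq:
  "flats_from h s = card {i. i < length s \<and> s ! i = 0 \<and> h + sum_list (take i s) = 0}"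
proof (induction s arbitrary: h)
  case (Cons a s)
  let ?A = "{i. i < length s \<and> s ! i = 0 \<and> (h + a) + sum_list (take i s) = 0}"
  have "{i. i < length (a # s) \<and> (a # s) ! i = 0 \<and> h + sum_list (take i (a # s)) = 0}
      = (if a = 0 \<and> h = 0 then {0} else {}) \<union> Suc ` ?A" (is "?L = ?R")
  proof (intro set_eqI)
    fix i show "i \<in> ?L \<longleftrightarrow> i \<in> ?R" by (cases i) (auto simp: add.assoc)
  qed
  moreover have "card (Suc ` ?A) = card ?A" by (simp add: card_image)
  moreover have "card ((if a = 0 \<and> h = 0 then {0} else {}) \<union> Suc ` ?A)
      = card (if a = 0 \<and> h = 0 then {0 :: nat} else {}) + card (Suc ` ?A)"
    by (rule card_Un_disjoint) auto
  moreover have "card (if a = 0 \<and> h = 0 then {0 :: nat} else {}) = (if a = 0 \<and> h = 0 then 1 else 0)"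
    by simp
  ultimately show ?case using Cons.IH[of "h + a"] by (simp only: flats_from.simps)
qed simp

definition motzkin_paths_from :: "nat \<Rightarrow> nat \<Rightarrow> nat \<Rightarrow> int list set" where
  "motzkin_paths_from h j k = {s. length s = k \<and> motzkin_from (int h) s \<and> flats_from (int h) s = j}"

definition motzkin_count :: "nat \<Rightarrow> nat \<Rightarrow> nat \<Rightarrow> nat" where
  "motzkin_count h j k = card (motzkin_paths_from h j k)"

lemma motzkin_M_eq_motzkin_count: "motzkin_M k j = motzkin_count 0 j k"
  by (simp add: motzkin_M_def motzkin_count_def motzkin_paths_from_def motzkin_path_def flats_at_zero_def motzkin_from_iff flats_from_eq)

lemma finite_motzkin_paths_from: "finite (motzkin_paths_from h j k)"
proof (rule finite_subset)
  show "motzkin_paths_from h j k \<subseteq> {s. set s \<subseteq> {-1, 0, 1} \<and> length s = k}"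
    by (auto simp: motzkin_paths_from_def motzkin_from_iff)
  show "finite {s. set s \<subseteq> {-1, 0, 1 :: int} \<and> length s = k}"
    by (rule finite_lists_length_eq) simp
qed

lemma card_Cons_image: "card ((#) a ` A) = card A"
  by (simp add: card_image)

lemma motzkin_count_0: "motzkin_count h j 0 = (if h = 0 \<and> j = 0 then 1 else 0)"
proof -
  have "motzkin_paths_from h j 0 = (if h = 0 \<and> j = 0 then {[]} else {})" by (auto simp: motzkin_paths_from_def)
  then show ?thesis by (simp add: motzkin_count_def)
qed

lemma motzkin_count_Suc_Suc:
  "motzkin_count (Suc h) j (Suc k) = motzkin_count (Suc (Suc h)) j k + motzkin_count (Suc h) j k + motzkin_count h j k"
proof -
  have "motzkin_paths_from (Suc h) j (Suc k) = (#) 1 ` motzkin_paths_from (Suc (Suc h)) j k \<union> (#) 0 ` motzkin_paths_from (Suc h) j k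
      \<union> (#) (-1) ` motzkin_paths_from h j k" (is "?A = ?B")
  proof (intro set_eqI)
    fix s show "s \<in> ?A \<longleftrightarrow> s \<in> ?B"
      by (cases s) (auto simp: motzkin_paths_from_def add.commute)
  qed
  moreover have "card ?B = card ((#) 1 ` motzkin_paths_from (Suc (Suc h)) j k \<union> (#) 0 ` motzkin_paths_from (Suc h) j k)
      + card ((#) (-1) ` motzkin_paths_from h j k)"
    by (rule card_Un_disjoint) (auto simp: finite_motzkin_paths_from)
  moreover have "card ((#) 1 ` motzkin_paths_from (Suc (Suc h)) j k \<union> (#) 0 ` motzkin_paths_from (Suc h) j k)
      = card ((#) 1 ` motzkin_paths_from (Suc (Suc h)) j k) + card ((#) 0 ` motzkin_paths_from (Suc h) j k)"
    by (rule card_Un_disjoint) (auto simp: finite_motzkin_paths_from)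
  ultimately show ?thesis by (simp only: motzkin_count_def card_Cons_image)
qed

text \<open>On the axis a down step is impossible, and a flat step uses up one of the
  \<open>j\<close> flats.\<close>

lemma motzkin_count_zero_Suc:
  "motzkin_count 0 j (Suc k) = motzkin_count 1 j k + (if j = 0 then 0 else motzkin_count 0 (j - 1) k)"
proof -
  have "motzkin_paths_from 0 j (Suc k) = (#) 1 ` motzkin_paths_from 1 j k \<union> (if j = 0 then {} else (#) 0 ` motzkin_paths_from 0 (j - 1) k)"
    (is "?A = ?B")
  proof (intro set_eqI)
    fix s show "s \<in> ?A \<longleftrightarrow> s \<in> ?B"
      by (cases s) (auto simp: motzkin_paths_from_def)
  qed
  moreover have "card ?B = card ((#) 1 ` motzkin_paths_from 1 j k)
      + card (if j = 0 then {} else (#) 0 ` motzkin_paths_from 0 (j - 1) k)"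
    by (rule card_Un_disjoint) (auto simp: finite_motzkin_paths_from)
  ultimately show ?thesis by (simp add: motzkin_count_def card_Cons_image)
qed

lemma flats_from_le: "flats_from h s \<le> length s"
  by (induction s arbitrary: h) (auto intro: le_SucI)

lemma motzkin_count_eq_0: "k < j \<Longrightarrow> motzkin_count h j k = 0"
proof -
  assume "k < j"
  then have "motzkin_paths_from h j k = {}" using flats_from_le[of "int h"] by (auto simp: motzkin_paths_from_def not_le[symmetric])
  then show ?thesis by (simp add: motzkin_count_def)
qed

definition motzkin_fps :: "nat \<Rightarrow> nat \<Rightarrow> rat fps" where
  "motzkin_fps h j = Abs_fps (\<lambda>k. of_nat (motzkin_count h j k))"

lemma motzkin_fps_Suc: "motzkin_fps (Suc h) j = fps_X * (motzkin_fps (Suc (Suc h)) j + motzkin_fps (Suc h) j + motzkin_fps h j)"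
proof (rule fps_ext)
  fix n show "motzkin_fps (Suc h) j $ n = (fps_X * (motzkin_fps (Suc (Suc h)) j + motzkin_fps (Suc h) j + motzkin_fps h j)) $ n"
    by (cases n) (auto simp: motzkin_fps_def motzkin_count_0 motzkin_count_Suc_Suc)
qed

lemma motzkin_fps_zero:
  "motzkin_fps 0 j = (if j = 0 then 1 else 0) + fps_X * (motzkin_fps 1 j + (if j = 0 then 0 else motzkin_fps 0 (j - 1)))"
proof (rule fps_ext)
  fix n show "motzkin_fps 0 j $ n = ((if j = 0 then 1 else 0) +
      fps_X * (motzkin_fps 1 j + (if j = 0 then 0 else motzkin_fps 0 (j - 1)))) $ n"
    by (cases n) (auto simp: motzkin_fps_def motzkin_count_0 motzkin_count_zero_Suc)
qed

text \<open>A factor without constant term gains one order of vanishing; this drives the coefficient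
  induction below.\<close>

lemma fps_mult_nth_zero_prefix:
  fixes a b :: "'a::semiring_0 fps"
  assumes "a $ 0 = 0" "\<And>k. k < n \<Longrightarrow> b $ k = 0"
  shows "(a * b) $ n = 0"
  unfolding fps_mult_nth
proof (rule sum.neutral, rule ballI)
  fix i assume "i \<in> {0..n}"
  then show "a $ i * b $ (n - i) = 0" using assms by (cases "i = 0") auto
qed

text \<open>Both sides satisfy the first-step recursions in \<open>h\<close> and \<open>j\<close>.
  Every term of the recursion for their difference \<open>E\<close> carries a factor
  \<open>D\<close>, which has no constant term, so all coefficients of \<open>E\<close> vanish by
  induction.\<close>

lemma cat_pos_fps_mult_motzkin_fps: "cat_pos_fps * (motzkin_fps h j oo cat_pos_fps) = layer_fps ^ Suc j * (layer_fps * inverse (1 - layer_fps)) ^ h"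
proof -
  \<comment> \<open>\<open>w\<close> is the factor for descending one level: \<open>wD\<close> is
    its first-step equation for steps up, flat and down.\<close>
  define w where "w = layer_fps * inverse (1 - layer_fps)"
  have w1: "w * (1 - layer_fps) = layer_fps"
    unfolding w_def mult.assoc by (subst inverse_mult_eq_1) auto
  have nz: "1 - layer_fps \<noteq> 0"
  proof
    assume "1 - layer_fps = 0"
    then have "(1 - layer_fps) $ 0 = 0" by simp
    then show False by simp
  qed
  have wD: "w = cat_pos_fps * (w * w + w + 1)"
  proof -
    have "(w - cat_pos_fps * (w * w + w + 1)) * ((1 - layer_fps) * (1 - layer_fps))
        = (w * (1 - layer_fps)) * (1 - layer_fps) - cat_pos_fps * ((w * (1 - layer_fps)) * (w * (1 - layer_fps)) + (w * (1 - layer_fps)) * (1 - layer_fps) + (1 - layer_fps) * (1 - layer_fps))"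
      by (simp add: algebra_simps)
    also have "\<dots> = 0" unfolding w1 using cat_pos_fps_layer_fps by (simp add: algebra_simps)
    finally show ?thesis using nz by simp
  qed
  \<comment> \<open>This is \<open>G = D + D G w\<close>, the first-step equation on the axis when
    no flat step is allowed there.\<close>
  have GD: "cat_pos_fps * (layer_fps * w) = layer_fps - cat_pos_fps"
  proof -
    have "(layer_fps - cat_pos_fps - cat_pos_fps * (layer_fps * w)) * (1 - layer_fps) = (layer_fps - cat_pos_fps) * (1 - layer_fps) - cat_pos_fps * layer_fps * (w * (1 - layer_fps))"
      by (simp add: algebra_simps)
    also have "\<dots> = 0" unfolding w1 using cat_pos_fps_layer_fps by (simp add: algebra_simps)
    finally show ?thesis using nz by simp
  qed
  define E where "E h j = cat_pos_fps * (motzkin_fps h j oo cat_pos_fps) - layer_fps ^ Suc j * w ^ h" for h j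
  have E_Suc: "E (Suc h) j = cat_pos_fps * (E (Suc (Suc h)) j + E (Suc h) j + E h j)" for h j
  proof -
    have c: "motzkin_fps (Suc h) j oo cat_pos_fps = cat_pos_fps * ((motzkin_fps (Suc (Suc h)) j oo cat_pos_fps) + (motzkin_fps (Suc h) j oo cat_pos_fps) + (motzkin_fps h j oo cat_pos_fps))"
      by (subst motzkin_fps_Suc) (simp add: fps_compose_mult_distrib fps_compose_add_distrib)
    have "w ^ h * (cat_pos_fps * (w * w + w + 1)) = w ^ h * w" by (simp only: wD[symmetric])
    then have p: "cat_pos_fps * (w ^ Suc (Suc h) + w ^ Suc h + w ^ h) = w ^ Suc h" by (simp add: algebra_simps)
    have "cat_pos_fps * (E (Suc (Suc h)) j + E (Suc h) j + E h j)
        = cat_pos_fps * (cat_pos_fps * ((motzkin_fps (Suc (Suc h)) j oo cat_pos_fps) + (motzkin_fps (Suc h) j oo cat_pos_fps) + (motzkin_fps h j oo cat_pos_fps)))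
          - layer_fps ^ Suc j * (cat_pos_fps * (w ^ Suc (Suc h) + w ^ Suc h + w ^ h))"
      by (simp add: E_def algebra_simps)
    also have "\<dots> = E (Suc h) j" by (simp only: c[symmetric] p E_def)
    finally show ?thesis by simp
  qed
  have E_0: "E 0 j = cat_pos_fps * (E 1 j + (if j = 0 then 0 else E 0 (j - 1)))" for j
  proof -
    have c: "motzkin_fps 0 j oo cat_pos_fps = (if j = 0 then 1 else 0) +
        cat_pos_fps * ((motzkin_fps 1 j oo cat_pos_fps) + (if j = 0 then 0 else motzkin_fps 0 (j - 1) oo cat_pos_fps))"
      by (subst motzkin_fps_zero) (simp add: fps_compose_mult_distrib fps_compose_add_distrib)
    show ?thesis
    proof (cases j)
      case 0
      have "E 0 j = cat_pos_fps + cat_pos_fps * (cat_pos_fps * (motzkin_fps 1 0 oo cat_pos_fps)) - layer_fps" using 0 c by (simp add: E_def distrib_left)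
      also have "\<dots> = cat_pos_fps * (cat_pos_fps * (motzkin_fps 1 0 oo cat_pos_fps)) - cat_pos_fps * (layer_fps * w)" unfolding GD by simp
      finally show ?thesis using 0 by (simp add: E_def right_diff_distrib)
    next
      case (Suc i)
      have "cat_pos_fps * (layer_fps ^ Suc j * w + layer_fps ^ Suc i) = layer_fps ^ Suc i * (cat_pos_fps * (layer_fps * w)) + cat_pos_fps * layer_fps ^ Suc i"
        using Suc by (simp add: algebra_simps)
      then have p: "cat_pos_fps * (layer_fps ^ Suc j * w + layer_fps ^ Suc i) = layer_fps ^ Suc j"
        unfolding GD using Suc by (simp add: algebra_simps)
      have "cat_pos_fps * (E 1 j + E 0 i) = cat_pos_fps * (cat_pos_fps * ((motzkin_fps 1 j oo cat_pos_fps) + (motzkin_fps 0 i oo cat_pos_fps))) - cat_pos_fps * (layer_fps ^ Suc j * w + layer_fps ^ Suc i)"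
        by (simp add: E_def algebra_simps)
      also have "\<dots> = E 0 j" unfolding p E_def using c Suc by simp
      finally show ?thesis using Suc by simp
    qed
  qed
  have "E h j $ n = 0" for h j n
  proof (induction n arbitrary: h j rule: less_induct)
    case (less n)
    show ?case
    proof (cases h)
      case 0
      show ?thesis unfolding 0
        by (subst E_0, rule fps_mult_nth_zero_prefix) (use less in auto)
    next
      case (Suc h')
      show ?thesis unfolding Suc
        by (subst E_Suc, rule fps_mult_nth_zero_prefix) (use less in auto)
    qed
  qed
  then have "E h j = 0" by (simp add: fps_eq_iff)
  then show ?thesis by (simp add: E_def w_def)
qed

section \<open>The stated sum as a coefficient, and the functional equations\<close>

text \<open>The expansion of \<open>1 - x\<close> to the power \<open>-(r + 1)\<close>.\<close>

definition neg_binomial_fps :: "nat \<Rightarrow> rat fps" where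
  "neg_binomial_fps r = Abs_fps (\<lambda>q. of_nat ((r + q) choose r))"

lemma neg_binomial_fps_0: "neg_binomial_fps 0 * (1 - fps_X) = 1"
proof (rule fps_ext)
  fix n show "(neg_binomial_fps 0 * (1 - fps_X)) $ n = 1 $ n"
    by (cases n) (simp_all add: neg_binomial_fps_def right_diff_distrib)
qed

lemma neg_binomial_fps_Suc: "neg_binomial_fps (Suc r) * (1 - fps_X) = neg_binomial_fps r"
proof (rule fps_ext)
  fix n show "(neg_binomial_fps (Suc r) * (1 - fps_X)) $ n = neg_binomial_fps r $ n"
    by (cases n) (simp_all add: neg_binomial_fps_def right_diff_distrib)
qed

text \<open>The series is expanded in powers of \<open>2 G\<close>, each power of \<open>G\<close>
  is rewritten as a Motzkin series in powers of \<open>D\<close>, and the two summations are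
  exchanged.\<close>

lemma formula_eq_nth_compose:
  assumes "1 \<le> m"
  shows "of_nat (\<Sum>k=1..m. \<Sum>l=2..k+1.
            2 ^ (l - 1) * ((r + l - 1) choose r) * motzkin_M (k - 1) (l - 2) *
            (\<Sum>xs\<in>compositions m k. prod_list (map catalan xs))) = (neg_binomial_fps r oo (2 * layer_fps)) $ m"
proof -
  have Gpow: "(layer_fps ^ Suc j) $ m = (\<Sum>k=1..m. of_nat (motzkin_count 0 j (k - 1)) * (cat_pos_fps ^ k) $ m)" for j
  proof -
    have "layer_fps ^ Suc j = (fps_X * motzkin_fps 0 j) oo cat_pos_fps"
      using cat_pos_fps_mult_motzkin_fps[of 0 j] by (simp add: fps_compose_mult_distrib)
    then have "(layer_fps ^ Suc j) $ m = (\<Sum>k=0..m. (fps_X * motzkin_fps 0 j) $ k * (cat_pos_fps ^ k) $ m)"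
      by (simp only: fps_compose_nth)
    also have "\<dots> = (\<Sum>k=1..m. (fps_X * motzkin_fps 0 j) $ k * (cat_pos_fps ^ k) $ m)"
      by (rule sum.mono_neutral_right) auto
    also have "\<dots> = (\<Sum>k=1..m. of_nat (motzkin_count 0 j (k - 1)) * (cat_pos_fps ^ k) $ m)"
      by (rule sum.cong) (auto simp: motzkin_fps_def)
    finally show ?thesis .
  qed
  have two: "((2 * layer_fps) ^ q) $ m = 2 ^ q * (layer_fps ^ q) $ m" for q
    by (simp add: power_mult_distrib numeral_fps_const fps_const_power)
  have "(neg_binomial_fps r oo (2 * layer_fps)) $ m = (\<Sum>q=0..m. of_nat ((r + q) choose r) * (2 ^ q * (layer_fps ^ q) $ m))"
    by (simp only: fps_compose_nth neg_binomial_fps_def fps_nth_Abs_fps two)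
  \<comment> \<open>The term \<open>q = 0\<close> is constant and drops out because
    \<open>m \<ge> 1\<close>.\<close>
  also have "\<dots> = (\<Sum>q=1..m. of_nat ((r + q) choose r) * (2 ^ q * (layer_fps ^ q) $ m))"
  proof (rule sum.mono_neutral_right)
    show "\<forall>q\<in>{0..m} - {1..m}. rat_of_nat ((r + q) choose r) * (2 ^ q * (layer_fps ^ q) $ m) = 0"
    proof
      fix q assume "q \<in> {0..m} - {1..m}"
      then have "q = 0" by auto
      then show "rat_of_nat ((r + q) choose r) * (2 ^ q * (layer_fps ^ q) $ m) = 0" using assms by simp
    qed
  qed auto
  also have "\<dots> = (\<Sum>q=1..m. \<Sum>k=1..m. of_nat ((r + q) choose r) * 2 ^ q *
      of_nat (motzkin_count 0 (q - 1) (k - 1)) * (cat_pos_fps ^ k) $ m)"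
  proof (rule sum.cong[OF refl])
    fix q assume "q \<in> {1..m}"
    then have "Suc (q - 1) = q" by simp
    then show "of_nat ((r + q) choose r) * (2 ^ q * (layer_fps ^ q) $ m) = (\<Sum>k=1..m.
        of_nat ((r + q) choose r) * 2 ^ q * of_nat (motzkin_count 0 (q - 1) (k - 1)) * (cat_pos_fps ^ k) $ m)"
      using Gpow[of "q - 1"] by (simp add: sum_distrib_left mult.assoc)
  qed
  also have "\<dots> = (\<Sum>k=1..m. \<Sum>q=1..m. of_nat ((r + q) choose r) * 2 ^ q *
      of_nat (motzkin_count 0 (q - 1) (k - 1)) * (cat_pos_fps ^ k) $ m)" by (rule sum.swap)
  \<comment> \<open>A path of length \<open>k - 1\<close> has at most \<open>k - 1\<close> flats, so
    the terms with \<open>q > k\<close> vanish.\<close>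
  also have "\<dots> = (\<Sum>k=1..m. \<Sum>q=1..k. of_nat ((r + q) choose r) * 2 ^ q *
      of_nat (motzkin_count 0 (q - 1) (k - 1)) * (cat_pos_fps ^ k) $ m)"
  proof (rule sum.cong[OF refl], rule sum.mono_neutral_right)
    fix k assume "k \<in> {1..m}"
    then show "{1..k} \<subseteq> {1..m}" by auto
    show "\<forall>q\<in>{1..m} - {1..k}. of_nat ((r + q) choose r) * 2 ^ q *
      of_nat (motzkin_count 0 (q - 1) (k - 1)) * (cat_pos_fps ^ k) $ m = 0"
    proof
      fix q assume "q \<in> {1..m} - {1..k}"
      then have "k - 1 < q - 1" using \<open>k \<in> {1..m}\<close> by auto
      then show "of_nat ((r + q) choose r) * 2 ^ q *
        of_nat (motzkin_count 0 (q - 1) (k - 1)) * (cat_pos_fps ^ k) $ m = 0" by (simp add: motzkin_count_eq_0)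
    qed
  qed auto
  \<comment> \<open>Reindexing by \<open>q = l - 1\<close>.\<close>
  also have "\<dots> = (\<Sum>k=1..m. \<Sum>l=2..k+1. of_nat ((r + l - 1) choose r) * 2 ^ (l - 1) *
      of_nat (motzkin_count 0 (l - 2) (k - 1)) * (cat_pos_fps ^ k) $ m)"
  proof (rule sum.cong[OF refl])
    fix k
    have "{2..k+1} = {Suc 1..Suc k}" by simp
    then show "(\<Sum>q=1..k. of_nat ((r + q) choose r) * 2 ^ q *
        of_nat (motzkin_count 0 (q - 1) (k - 1)) * (cat_pos_fps ^ k) $ m) =
      (\<Sum>l=2..k+1. of_nat ((r + l - 1) choose r) * 2 ^ (l - 1) *
        of_nat (motzkin_count 0 (l - 2) (k - 1)) * (cat_pos_fps ^ k) $ m)"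
      by (simp only: sum.shift_bounds_cl_Suc_ivl) (simp add: numeral_2_eq_2)
  qed
  finally show ?thesis
    by (simp add: sum_compositions_catalan[symmetric] motzkin_M_eq_motzkin_count mult_ac sum_distrib_left)
qed

text \<open>
  The sequence \<open>A (t + 1) - G A t\<close> is geometric with ratio \<open>1 - G\<close>, a unit, and tends to zero; so it
  vanishes identically.
\<close>
lemma catalan_ladder:
  fixes A :: "nat \<Rightarrow> rat fps"
  assumes rec: "\<And>t. 2 \<le> t \<Longrightarrow> A t = A (Suc t) + xcat_fps * A (t - 1)"
    and small: "\<And>n. \<exists>t0. \<forall>t\<ge>t0. \<forall>k\<le>n. A t $ k = 0"
  shows "A 2 = layer_fps * A 1"
proof -
  define E where "E t = A (Suc t) - layer_fps * A t" for t
  have E_Suc: "E (Suc t) = (1 - layer_fps) * E t" if "1 \<le> t" for t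
  proof -
    have "A (Suc t) = A (Suc (Suc t)) + xcat_fps * A t" using rec[of "Suc t"] that by simp
    then show ?thesis unfolding E_def xcat_fps_eq by (simp add: algebra_simps)
  qed
  have E_pow: "E (Suc s) = (1 - layer_fps) ^ s * E 1" for s
    by (induction s) (simp_all add: E_Suc mult.assoc)
  have "E 1 $ n = 0" for n
  proof -
    obtain t0 where t0: "\<forall>t\<ge>t0. \<forall>k\<le>n. A t $ k = 0" using small by blast
    then have z: "E (Suc t0) $ k = 0" if "k \<le> n" for k
      using that by (auto simp: E_def fps_mult_nth)
    have "((1 - layer_fps) ^ t0) $ 0 \<noteq> 0" by (simp add: fps_power_zeroth)
    then have "E 1 = inverse ((1 - layer_fps) ^ t0) * E (Suc t0)"
      unfolding E_pow mult.assoc[symmetric] by (subst inverse_mult_eq_1) auto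
    then show ?thesis using z by (auto simp: fps_mult_nth)
  qed
  then have "E 1 = 0" by (simp add: fps_eq_iff)
  then show ?thesis by (simp add: E_def numeral_2_eq_2)
qed

text \<open>Both sides obey the same recursion in \<open>r\<close>, and the nonzero factor
  \<open>1 - 2 G\<close> can be cancelled.\<close>

lemma series_solution:
  assumes "T 0 * (1 - 2 * layer_fps) = 1" "\<And>r. T (Suc r) * (1 - 2 * layer_fps) = T r"
  shows "T r = neg_binomial_fps r oo (2 * layer_fps)"
proof -
  have G2: "(2 * layer_fps) $ 0 = 0" by simp
  have nz: "1 - 2 * layer_fps \<noteq> 0"
  proof
    assume "1 - 2 * layer_fps = 0"
    then have "(1 - 2 * layer_fps) $ 0 = 0" by simp
    then show False by simp
  qed
  have X: "(1 - fps_X) oo (2 * layer_fps) = 1 - 2 * layer_fps"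
    by (simp add: fps_compose_sub_distrib)
  show ?thesis
  proof (induction r)
    case 0
    have "(neg_binomial_fps 0 oo (2 * layer_fps)) * (1 - 2 * layer_fps) = (neg_binomial_fps 0 * (1 - fps_X)) oo (2 * layer_fps)"
      using fps_compose_mult_distrib[OF G2, of "neg_binomial_fps 0" "1 - fps_X"] X by simp
    then have "(neg_binomial_fps 0 oo (2 * layer_fps)) * (1 - 2 * layer_fps) = T 0 * (1 - 2 * layer_fps)"
      by (simp add: neg_binomial_fps_0 assms)
    then show ?case using nz by simp
  next
    case (Suc r)
    have "(neg_binomial_fps (Suc r) oo (2 * layer_fps)) * (1 - 2 * layer_fps) = (neg_binomial_fps (Suc r) * (1 - fps_X)) oo (2 * layer_fps)"
      using fps_compose_mult_distrib[OF G2, of "neg_binomial_fps (Suc r)" "1 - fps_X"] X by simp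
    then have "(neg_binomial_fps (Suc r) oo (2 * layer_fps)) * (1 - 2 * layer_fps) = T (Suc r) * (1 - 2 * layer_fps)"
      by (simp add: neg_binomial_fps_Suc assms Suc)
    then show ?case using nz by simp
  qed
qed

section \<open>Counting\<close>

text \<open>The last value reveals \<open>K\<close>, hence the layout; \<open>\<alpha>\<close> and
  \<open>\<sigma>\<close> are then read off region by region.\<close>

lemma insert_block_inj_same_size:
  assumes "block_insertion L i j \<alpha> \<sigma>" "block_insertion L i j' \<alpha>' \<sigma>'"
    and eq: "insert_block L i j \<alpha> \<sigma> = insert_block L i j' \<alpha>' \<sigma>'"
  shows "\<alpha> = \<alpha>' \<and> \<sigma> = \<sigma>'"
proof -
  interpret A: block_insertion L i j \<alpha> \<sigma> by fact
  interpret B: block_insertion L i j' \<alpha>' \<sigma>' by fact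
  have p: "B.p = A.p" by (simp add: A.p_def B.p_def eq)
  have "A.K + 2 * i - 1 = B.K + 2 * i - 1" using A.p_last B.p_last p by metis
  then have K: "B.K = A.K" using A.i_pos by linarith
  have e: "B.e = A.e" by (intro ext) (simp add: A.e_def B.e_def K)
  have "\<alpha> x = \<alpha>' x" for x
  proof (cases "x < i")
    case True
    then show ?thesis using A.p_low[of x] B.p_low[of x] p by simp
  next
    case False
    then show ?thesis using permutes_not_in[OF A.\<alpha>_perm, of x] permutes_not_in[OF B.\<alpha>_perm, of x] by simp
  qed
  moreover have "\<sigma> x = \<sigma>' x" for x
  proof (cases "x < L")
    case True
    then have "A.e (\<sigma> x) = A.e (\<sigma>' x)" using A.p_e[of x] B.p_e[of x] p e by metis
    then show ?thesis by simp
  next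
    case False
    then show ?thesis using permutes_not_in[OF A.\<sigma>_perm, of x] permutes_not_in[OF B.\<sigma>_perm, of x] by simp
  qed
  ultimately show ?thesis by auto
qed

text \<open>The position of the maximum is \<open>i - 1\<close>, which reduces the claim to equal
  block sizes.\<close>

lemma insert_block_inj:
  assumes bl: "block_insertion L i j \<alpha> \<sigma>" "block_insertion L' i' j' \<alpha>' \<sigma>'"
    and N: "L + 3 * i = L' + 3 * i'" and eq: "insert_block L i j \<alpha> \<sigma> = insert_block L' i' j' \<alpha>' \<sigma>'"
  shows "i = i' \<and> \<alpha> = \<alpha>' \<and> \<sigma> = \<sigma>'"
proof -
  interpret A: block_insertion L i j \<alpha> \<sigma> by fact
  interpret B: block_insertion L' i' j' \<alpha>' \<sigma>' by fact
  have p: "B.p = A.p" by (simp add: A.p_def B.p_def eq)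
  have "A.p (i - 1) = A.p (i' - 1)" using A.p_max B.p_max N p by metis
  then have "i - 1 = i' - 1" using permutes_inj[OF A.p_perm] by (simp add: inj_eq)
  then have i: "i' = i" using A.i_pos B.i_pos by linarith
  then have L: "L' = L" using N by simp
  show ?thesis using insert_block_inj_same_size[of L i j \<alpha> \<sigma> j' \<alpha>' \<sigma>'] bl eq i L by simp
qed

text \<open>As \<open>i > 0\<close>, the site 0 is not a shifted one, so insertion at the
  \<open>s\<close>-th site leaves \<open>s + 1\<close> sites.\<close>

lemma (in block_insertion) card_sites_p:
  "card (sites (L + 3 * i) p) = Suc (card {v \<in> sites L \<sigma>. v \<le> j})"
proof -
  have "finite {v \<in> sites L \<sigma>. v \<le> j}" by (rule finite_subset[OF _ finite_sites[of L \<sigma>]]) auto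
  then show ?thesis unfolding sites_p using i_pos by (subst card_insert_disjoint) (auto simp: card_image)
qed

text \<open>For a nonzero site \<open>k\<close>, the position \<open>p b\<close> of the maximum is
  below \<open>k\<close>. It is not \<open>b\<close>, so \<open>b < p b\<close> and thus
  \<open>b + 1 < k\<close>. But the last \<open>k\<close> values increase up to \<open>b\<close>,
  and only \<open>b + 1\<close> values are available.\<close>

lemma sites_eq_zero:
  assumes perm: "p permutes {..<N}" and cube: "\<And>x. p (p (p x)) = x"
    and notA: "\<not> p (p (N - 1)) < p (N - 1)"
  shows "sites N p = {0}"
proof -
  have "k = 0" if k: "k \<in> sites N p" for k
  proof (rule ccontr)
    assume k0: "k \<noteq> 0"
    define b where "b = p (N - 1)"
    have k2: "2 * k \<le> N" using k by (simp add: sites_def)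
    then have bN: "b < N" using k0 permutes_lessThan_iff[OF perm] by (simp add: b_def)
    have top: "N - k \<le> p x \<longleftrightarrow> x < k" if "x < N" for x
      using top_values_iff[OF perm _ _ that, of k] k k2 by (auto simp: sites_def)
    have "p (p b) = N - 1" by (simp add: b_def cube)
    moreover have "p b < N" using bN permutes_lessThan_iff[OF perm] by simp
    moreover have "N - k \<le> N - 1" using k0 by linarith
    ultimately have pbk: "p b < k" using top[of "p b"] by simp
    have "p b \<noteq> b"
    proof
      assume "p b = b"
      then have "b = N - 1" using cube[of "N - 1"] by (simp add: b_def)
      then show False using pbk \<open>p b = b\<close> k2 by simp
    qed
    then have bk: "Suc b < k" using notA pbk by (simp add: b_def)
    have "p ` {N - k..<N} \<subseteq> {..b}"
    proof
      fix y assume "y \<in> p ` {N - k..<N}"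
      then obtain x where x: "y = p x" "N - k \<le> x" "x < N" by auto
      have "x = N - 1 \<or> x < N - 1" using x by linarith
      moreover have "p x < p (N - 1)" if "x < N - 1" using k x that by (simp add: sites_def)
      ultimately have "x = N - 1 \<or> p x < p (N - 1)" by blast
      then show "y \<in> {..b}" using x by (auto simp: b_def)
    qed
    then have "card (p ` {N - k..<N}) \<le> Suc b" using card_mono[of "{..b}"] by fastforce
    moreover have "card (p ` {N - k..<N}) = k"
      using permutes_inj[OF perm] k2 by (simp add: card_image inj_on_subset)
    ultimately show False using bk by simp
  qed
  then show ?thesis using zero_in_sites by blast
qed

text \<open>Appending a maximum at the end never creates a 132. This counts the admissible
  \<open>\<alpha>\<close> and also removes a fixed last point.\<close>

lemma av132_iff_Suc_last_fixed: "\<alpha> \<in> av132 n \<longleftrightarrow> \<alpha> permutes {..<Suc n} \<and> avoids132 \<alpha> (Suc n) \<and> \<alpha> n = n"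
proof -
  have perm: "\<alpha> permutes {..<n} \<longleftrightarrow> \<alpha> permutes {..<Suc n} \<and> \<alpha> n = n"
  proof
    assume "\<alpha> permutes {..<n}"
    then show "\<alpha> permutes {..<Suc n} \<and> \<alpha> n = n"
      using permutes_subset[of \<alpha> "{..<n}" "{..<Suc n}"] permutes_not_in[of \<alpha> "{..<n}" n] by auto
  next
    assume "\<alpha> permutes {..<Suc n} \<and> \<alpha> n = n"
    then have a: "\<alpha> permutes {..<Suc n}" "\<alpha> n = n" by auto
    show "\<alpha> permutes {..<n}"
    proof (rule permutes_superset[OF a(1)])
      fix x assume "x \<in> {..<Suc n} - {..<n}"
      then have "x = n" by auto
      then show "\<alpha> x = x" using a(2) by simp
    qed
  qed
  have "avoids132 \<alpha> n \<longleftrightarrow> avoids132 \<alpha> (Suc n)" if p: "\<alpha> permutes {..<n}"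
  proof
    assume a: "avoids132 \<alpha> n"
    have "\<alpha> y \<le> \<alpha> z" if "x < y" "y < z" "z < Suc n" "\<alpha> x < \<alpha> z" for x y z
    proof (cases "z = n")
      case True
      have "\<alpha> n = n" using permutes_not_in[OF p, of n] by simp
      moreover have "\<alpha> y < n" using that True permutes_lessThan_iff[OF p] by simp
      ultimately show ?thesis using True by simp
    next
      case False
      then show ?thesis using that avoids132D[OF a] by simp
    qed
    then show "avoids132 \<alpha> (Suc n)" unfolding avoids132_def by (meson not_le)
  next
    assume "avoids132 \<alpha> (Suc n)"
    then show "avoids132 \<alpha> n" unfolding avoids132_def by (meson less_SucI)
  qed
  then show ?thesis using perm by (auto simp: av132_def)
qed

text \<open>The rank is strictly increasing on \<open>V\<close> with values in
  \<open>{1..card V}\<close>, hence a bijection.\<close>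

lemma ex1_element_of_rank:
  fixes V :: "nat set"
  assumes "finite V" "1 \<le> s" "s \<le> card V"
  shows "\<exists>!j. j \<in> V \<and> card {v \<in> V. v \<le> j} = s"
proof -
  define f where "f j = card {v \<in> V. v \<le> j}" for j
  have less: "f j < f j'" if "j' \<in> V" "j < j'" for j j'
  proof -
    have "j' \<in> {v \<in> V. v \<le> j'}" "j' \<notin> {v \<in> V. v \<le> j}" "{v \<in> V. v \<le> j} \<subseteq> {v \<in> V. v \<le> j'}"
      using that by auto
    then have "{v \<in> V. v \<le> j} \<subset> {v \<in> V. v \<le> j'}" by blast
    then show ?thesis unfolding f_def using assms(1) by (intro psubset_card_mono) auto
  qed
  have inj: "inj_on f V"
    by (rule inj_onI) (metis less nat_neq_iff)
  have "f ` V = {1..card V}"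
  proof (rule card_subset_eq)
    show "f ` V \<subseteq> {1..card V}"
    proof
      fix y assume "y \<in> f ` V"
      then obtain j where j: "j \<in> V" "y = f j" by auto
      have "{j} \<subseteq> {v \<in> V. v \<le> j}" using j by auto
      then have "1 \<le> f j" unfolding f_def using assms(1) card_mono[of "{v \<in> V. v \<le> j}" "{j}"] by simp
      moreover have "f j \<le> card V" unfolding f_def using assms(1) by (intro card_mono) auto
      ultimately show "y \<in> {1..card V}" using j by simp
    qed
    show "card (f ` V) = card {1..card V}" using inj by (simp add: card_image)
  qed simp
  then have "s \<in> f ` V" using assms by simp
  then show ?thesis using inj by (auto simp: f_def inj_on_def)
qed

section \<open>Counting by the number of sites\<close>

definition element_of_rank :: "nat set \<Rightarrow> nat \<Rightarrow> nat" where
  "element_of_rank V s = (THE j. j \<in> V \<and> card {v \<in> V. v \<le> j} = s)"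

definition tri_perms_ge :: "nat \<Rightarrow> nat \<Rightarrow> nat \<Rightarrow> (nat \<Rightarrow> nat) set" where
  "tri_perms_ge t N m = {p \<in> tri_perms N m. t \<le> card (sites N p)}"

lemma finite_tri_perms: "finite (tri_perms N m)"
  by (rule finite_subset[OF _ finite_permutations[of "{..<N}"]]) (auto simp: tri_perms_def)

lemma finite_tri_perms_ge: "finite (tri_perms_ge t N m)"
  by (rule finite_subset[OF _ finite_tri_perms[of N m]]) (auto simp: tri_perms_ge_def)

lemma finite_av132: "finite (av132 n)"
  by (rule finite_subset[OF _ finite_permutations[of "{..<n}"]]) (auto simp: av132_def)

text \<open>Inserting at site number \<open>t - 1\<close> is a bijection from triples
  \<open>(i, \<alpha>, \<sigma>)\<close>, where \<open>\<sigma>\<close> needs at least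
  \<open>t - 1\<close> sites. For surjectivity, \<open>t \<ge> 2\<close> gives a nonzero site and
  hence a block to remove.\<close>

lemma card_tri_perms_sites_eq:
  assumes t: "2 \<le> t" and N: "3 * m \<le> N"
  shows "card {p \<in> tri_perms N m. card (sites N p) = t} =
    (\<Sum>i=1..m. card (av132 (i - 1)) * card (tri_perms_ge (t - 1) (N - 3 * i) (m - i)))"
proof -
  define I where "I = (SIGMA i:{1..m}. av132 (i - 1) \<times> tri_perms_ge (t - 1) (N - 3 * i) (m - i))"
  define J where "J i \<sigma> = element_of_rank (sites (N - 3 * i) \<sigma>) (t - 1)" for i \<sigma>
  define F where "F = (\<lambda>(i, \<alpha>, \<sigma>). insert_block (N - 3 * i) i (J i \<sigma>) \<alpha> \<sigma>)"
  have block: "block_insertion (N - 3 * i) i (J i \<sigma>) \<alpha> \<sigma> \<and>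
      card {v \<in> sites (N - 3 * i) \<sigma>. v \<le> J i \<sigma>} = t - 1 \<and> N - 3 * i + 3 * i = N \<and>
      card {x. \<sigma> x \<noteq> x} + 3 * i = 3 * m"
    if "(i, \<alpha>, \<sigma>) \<in> I" for i \<alpha> \<sigma>
  proof -
    have i: "1 \<le> i" "i \<le> m" and \<alpha>: "\<alpha> \<in> av132 (i - 1)" and \<sigma>: "\<sigma> \<in> tri_perms (N - 3 * i) (m - i)"
      and c: "t - 1 \<le> card (sites (N - 3 * i) \<sigma>)"
      using that by (auto simp: I_def tri_perms_ge_def)
    have J: "J i \<sigma> \<in> sites (N - 3 * i) \<sigma> \<and> card {v \<in> sites (N - 3 * i) \<sigma>. v \<le> J i \<sigma>} = t - 1"
      unfolding J_def element_of_rank_def by (rule theI', rule ex1_element_of_rank) (use c t in auto)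
    have "Suc (i - 1) = i" using i by simp
    then have "block_insertion (N - 3 * i) i (J i \<sigma>) \<alpha> \<sigma>"
      using i J \<sigma> \<alpha>[unfolded av132_iff_Suc_last_fixed] by unfold_locales (auto simp: tri_perms_def)
    then show ?thesis using J i N \<sigma> by (auto simp: tri_perms_def)
  qed
  have "bij_betw F I {p \<in> tri_perms N m. card (sites N p) = t}"
    unfolding bij_betw_def
  proof (intro conjI equalityI subsetI)
    show "inj_on F I"
    proof (rule inj_onI)
      fix a b assume ab: "a \<in> I" "b \<in> I" "F a = F b"
      obtain i \<alpha> \<sigma> i' \<alpha>' \<sigma>' where "a = (i, \<alpha>, \<sigma>)" "b = (i', \<alpha>', \<sigma>')" by (metis prod_cases3)
      then show "a = b" using ab block[of i \<alpha> \<sigma>] block[of i' \<alpha>' \<sigma>'] insert_block_inj by (auto simp: F_def)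
    qed
  next
    fix p assume "p \<in> F ` I"
    then obtain i \<alpha> \<sigma> where I: "(i, \<alpha>, \<sigma>) \<in> I" and p: "p = insert_block (N - 3 * i) i (J i \<sigma>) \<alpha> \<sigma>"
      by (auto simp: F_def)
    note b = block[OF I]
    interpret B: block_insertion "N - 3 * i" i "J i \<sigma>" \<alpha> \<sigma> using b by blast
    have p: "p = B.p" using p by (simp add: B.p_def)
    have N: "N - 3 * i + 3 * i = N" using b by blast
    show "p \<in> {p \<in> tri_perms N m. card (sites N p) = t}"
      using B.p_perm B.p_av B.p_cube B.moved_p B.card_sites_p b t unfolding p N by (auto simp: tri_perms_def)
  next
    fix p assume "p \<in> {p \<in> tri_perms N m. card (sites N p) = t}"
    then have p: "p \<in> tri_perms N m" "card (sites N p) = t" by auto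
    have pp: "p permutes {..<N}" "avoids132 p N" and cube: "\<And>x. p (p (p x)) = x"
      using p by (auto simp: tri_perms_def)
    have "sites N p \<noteq> {0}"
    proof
      assume "sites N p = {0}"
      then show False using p(2) t by simp
    qed
    then have "p (p (N - 1)) < p (N - 1)" using sites_eq_zero[OF pp(1) cube] by blast
    then obtain L i j \<alpha> \<sigma> where b: "block_insertion L i j \<alpha> \<sigma>" and NL: "N = L + 3 * i"
      and pi: "p = insert_block L i j \<alpha> \<sigma>"
      using block_decomposition[OF pp cube] by blast
    interpret B: block_insertion L i j \<alpha> \<sigma> by (rule b)
    have pB: "p = B.p" using pi by (simp add: B.p_def)
    have L: "L = N - 3 * i" using NL by simp
    have mv: "card {x. \<sigma> x \<noteq> x} + 3 * i = 3 * m" using B.moved_p p pB by (simp add: tri_perms_def)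
    have st: "card {v \<in> sites L \<sigma>. v \<le> j} = t - 1" using B.card_sites_p p pB NL by simp
    have "card {v \<in> sites L \<sigma>. v \<le> j} \<le> card (sites L \<sigma>)" by (rule card_mono) auto
    then have "t - 1 \<le> card (sites L \<sigma>)" using st by simp
    then have ex1: "\<exists>!j. j \<in> sites L \<sigma> \<and> card {v \<in> sites L \<sigma>. v \<le> j} = t - 1"
      using t by (intro ex1_element_of_rank) auto
    have "J i \<sigma> = j" unfolding J_def element_of_rank_def L[symmetric]
      by (rule the1_equality[OF ex1]) (use B.j_site st in auto)
    moreover have "Suc (i - 1) = i" using B.i_pos by simp
    then have "\<alpha> \<in> av132 (i - 1)" unfolding av132_iff_Suc_last_fixed using B.\<alpha>_perm B.\<alpha>_av B.\<alpha>_last by simp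
    moreover have "\<sigma> \<in> tri_perms L (m - i)"
      using B.\<sigma>_perm B.\<sigma>_av B.\<sigma>_cube mv by (auto simp: tri_perms_def)
    ultimately have "(i, \<alpha>, \<sigma>) \<in> I \<and> F (i, \<alpha>, \<sigma>) = p"
      using \<open>t - 1 \<le> card (sites L \<sigma>)\<close> mv B.i_pos L pi by (auto simp: I_def F_def tri_perms_ge_def)
    then show "p \<in> F ` I" by force
  qed
  then have "card {p \<in> tri_perms N m. card (sites N p) = t} = card I"
    by (simp add: bij_betw_same_card)
  also have "\<dots> = (\<Sum>i=1..m. card (av132 (i - 1)) * card (tri_perms_ge (t - 1) (N - 3 * i) (m - i)))"
    unfolding I_def by (simp add: finite_av132 finite_tri_perms_ge card_cartesian_product)
  finally show ?thesis .
qed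

lemma tri_perms_last_fixed: "{p \<in> tri_perms (Suc N) m. p N = N} = tri_perms N m"
  using av132_iff_Suc_last_fixed[of _ N] by (auto simp: tri_perms_def av132_def)

text \<open>Here \<open>p \<circ> p\<close> is the inverse of \<open>p\<close>, so avoidance is
  inherited.\<close>

lemma tri_perms_comp_self:
  assumes p: "p \<in> tri_perms N m"
  shows "p \<circ> p \<in> tri_perms N m"
proof -
  have perm: "p permutes {..<N}" and a: "avoids132 p N" and cube: "\<And>x. p (p (p x)) = x"
    and mv: "card {x. p x \<noteq> x} = 3 * m" using p by (auto simp: tri_perms_def)
  have "inv p = p \<circ> p"
    by (rule ext) (simp add: permutes_inv_eq[OF perm] cube)
  then have "avoids132 (p \<circ> p) N" using avoids132_inv[OF perm a] by simp
  moreover have "p (p x) = x \<longleftrightarrow> p x = x" for x using cube by metis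
  ultimately show ?thesis using perm cube mv permutes_compose[OF perm perm] by (simp add: tri_perms_def)
qed

text \<open>The last point is fixed, or \<open>p (p N)\<close> lies below or above
  \<open>p N\<close>; squaring exchanges the last two classes. The class \<open>?A\<close> is
  characterised by a second site: removing a block shows one direction, \<open>sites_eq_zero\<close>
  the other.\<close>

lemma card_tri_perms_Suc: "card (tri_perms (Suc N) m) = card (tri_perms N m) + 2 * card (tri_perms_ge 2 (Suc N) m)"
proof -
  let ?A = "{p \<in> tri_perms (Suc N) m. p (p N) < p N}"
  let ?B = "{p \<in> tri_perms (Suc N) m. p N < p (p N)}"
  let ?C = "{p \<in> tri_perms (Suc N) m. p N = N}"
  have eqC: "p N = p (p N) \<longleftrightarrow> p N = N" if "p \<in> tri_perms (Suc N) m" for p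
    using that unfolding tri_perms_def by (metis (mono_tags, lifting) mem_Collect_eq)
  have un: "tri_perms (Suc N) m = ?C \<union> (?A \<union> ?B)"
  proof (intro equalityI subsetI)
    fix p assume "p \<in> tri_perms (Suc N) m"
    then show "p \<in> ?C \<union> (?A \<union> ?B)"
      using eqC[of p] by (cases "p N" "p (p N)" rule: linorder_cases) auto
  qed auto
  have fin: "finite ?A" "finite ?B" "finite ?C" using finite_tri_perms[of "Suc N" m] by auto
  have dis: "?A \<inter> ?B = {}" "?C \<inter> (?A \<union> ?B) = {}" by auto
  have "bij_betw (\<lambda>p. p \<circ> p) ?A ?B"
  proof (rule bij_betw_byWitness[where f' = "\<lambda>p. p \<circ> p"])
    show "\<forall>p\<in>?A. (p \<circ> p) \<circ> (p \<circ> p) = p" "\<forall>p\<in>?B. (p \<circ> p) \<circ> (p \<circ> p) = p"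
      by (auto simp: tri_perms_def fun_eq_iff)
    show "(\<lambda>p. p \<circ> p) ` ?A \<subseteq> ?B" "(\<lambda>p. p \<circ> p) ` ?B \<subseteq> ?A"
      using tri_perms_comp_self by (auto simp: tri_perms_def)
  qed
  then have AB: "card ?B = card ?A" by (simp add: bij_betw_same_card)
  have A: "?A = tri_perms_ge 2 (Suc N) m"
  proof (intro equalityI subsetI)
    fix p assume p: "p \<in> ?A"
    then have pp: "p permutes {..<Suc N}" "avoids132 p (Suc N)" and cube: "\<And>x. p (p (p x)) = x"
      and A: "p (p (Suc N - 1)) < p (Suc N - 1)" by (auto simp: tri_perms_def)
    obtain L i j \<alpha> \<sigma> where b: "block_insertion L i j \<alpha> \<sigma>" and NL: "Suc N = L + 3 * i"
      and pi: "p = insert_block L i j \<alpha> \<sigma>"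
      using block_decomposition[OF pp cube A] by blast
    interpret B: block_insertion L i j \<alpha> \<sigma> by (rule b)
    have "finite {v \<in> sites L \<sigma>. v \<le> j}" "0 \<in> {v \<in> sites L \<sigma>. v \<le> j}" by auto
    then have "card {v \<in> sites L \<sigma>. v \<le> j} \<noteq> 0" by (metis card_eq_0_iff empty_iff)
    then have "2 \<le> card (sites (Suc N) p)" using B.card_sites_p unfolding B.p_def NL pi by linarith
    then show "p \<in> tri_perms_ge 2 (Suc N) m"
      using p by (simp add: tri_perms_ge_def)
  next
    fix p assume p: "p \<in> tri_perms_ge 2 (Suc N) m"
    then have pp: "p permutes {..<Suc N}" and cube: "\<And>x. p (p (p x)) = x" and t: "p \<in> tri_perms (Suc N) m"
      and "2 \<le> card (sites (Suc N) p)" by (auto simp: tri_perms_ge_def tri_perms_def)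
    have "sites (Suc N) p \<noteq> {0}"
    proof
      assume "sites (Suc N) p = {0}"
      then show False using \<open>2 \<le> card (sites (Suc N) p)\<close> by simp
    qed
    then have "p (p (Suc N - 1)) < p (Suc N - 1)" using sites_eq_zero[OF pp cube] by blast
    then show "p \<in> ?A" using t by simp
  qed
  have "card (tri_perms (Suc N) m) = card ?C + card (?A \<union> ?B)"
    by (subst un) (rule card_Un_disjoint, use fin dis in auto)
  also have "card (?A \<union> ?B) = card ?A + card ?B"
    by (rule card_Un_disjoint) (use fin dis in auto)
  finally show ?thesis using tri_perms_last_fixed AB A by simp
qed

section \<open>Catalan numbers count 132-avoiding permutations\<close>

text \<open>The general shape of a 132-avoider: the maximum at position \<open>i\<close>, with all
  values to its left above all values to its right.\<close>

definition join_at_max :: "nat \<Rightarrow> nat \<Rightarrow> (nat \<Rightarrow> nat) \<Rightarrow> (nat \<Rightarrow> nat) \<Rightarrow> nat \<Rightarrow> nat" where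
  "join_at_max i k l r x = (if x < i then k + l x else if x = i then i + k
     else if x \<le> i + k then r (x - Suc i) else x)"

text \<open>In a pattern, \<open>z\<close> cannot be the maximum. If it is left of it, the pattern
  lies in \<open>l\<close>; if right of it, the value at \<open>x\<close> is below \<open>k\<close>,
  so the pattern lies in \<open>r\<close>.\<close>

lemma join_at_max_in_av132:
  assumes l: "l \<in> av132 i" and r: "r \<in> av132 k"
  shows "join_at_max i k l r \<in> av132 (Suc (i + k))"
proof -
  have lp: "l permutes {..<i}" and rp: "r permutes {..<k}" using l r by (auto simp: av132_def)
  have ll: "l x < i \<longleftrightarrow> x < i" and rl: "r x < k \<longleftrightarrow> x < k" for x
    using permutes_lessThan_iff[OF lp] permutes_lessThan_iff[OF rp] by auto
  have li: "l x = l y \<longleftrightarrow> x = y" and ri: "r x = r y \<longleftrightarrow> x = y" for x y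
    using permutes_inj[OF lp] permutes_inj[OF rp] by (auto simp: inj_eq)
  let ?p = "join_at_max i k l r"
  have low: "?p x = k + l x" "k \<le> ?p x" "?p x < i + k" if "x < i" for x
    using that ll[of x] by (auto simp: join_at_max_def)
  have mid: "?p i = i + k" by (simp add: join_at_max_def)
  have high: "?p x = r (x - Suc i)" "?p x < k" if "i < x" "x < Suc (i + k)" for x
    using that rl[of "x - Suc i"] by (auto simp: join_at_max_def)
  have "?p permutes {..<Suc (i + k)}"
  proof (rule bij_imp_permutes)
    have "?p x \<noteq> ?p y" if xy: "x < y" "y < Suc (i + k)" for x y
    proof -
      consider "y < i" | "y = i" | "x < i" "i < y" | "x = i" "i < y" | "i < x" using xy by linarith
      then show ?thesis
      proof cases
        case 1
        then show ?thesis using xy low by (simp add: li)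
      next
        case 2
        then show ?thesis using xy low(3)[of x] mid by simp
      next
        case 3
        then show ?thesis using xy low(2)[of x] high(2)[of y] by simp
      next
        case 4
        then show ?thesis using xy mid high(2)[of y] by simp
      next
        case 5
        then have "x - Suc i \<noteq> y - Suc i" using xy by simp
        then show ?thesis using 5 xy high(1)[of x] high(1)[of y] by (simp add: ri)
      qed
    qed
    then have "inj_on ?p {..<Suc (i + k)}"
      by (intro inj_onI) (metis lessThan_iff linorder_neqE_nat)
    moreover have "?p ` {..<Suc (i + k)} \<subseteq> {..<Suc (i + k)}"
    proof
      fix y assume "y \<in> ?p ` {..<Suc (i + k)}"
      then obtain x where x: "y = ?p x" "x < Suc (i + k)" by auto
      consider "x < i" | "x = i" | "i < x" by linarith
      then show "y \<in> {..<Suc (i + k)}"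
      proof cases
        case 1
        then show ?thesis using low(3)[of x] x by simp
      next
        case 2
        then show ?thesis using mid x by simp
      next
        case 3
        then show ?thesis using high(2)[of x] x by simp
      qed
    qed
    ultimately show "bij_betw ?p {..<Suc (i + k)} {..<Suc (i + k)}"
      by (simp add: bij_betw_def endo_inj_surj)
  qed (simp add: join_at_max_def)
  moreover have "avoids132 ?p (Suc (i + k))"
    unfolding avoids132_def
  proof (intro notI, elim exE conjE)
    fix x y z assume h: "x < y" "y < z" "z < Suc (i + k)" "?p x < ?p z" "?p z < ?p y"
    consider "z < i" | "z = i" | "i < z" by linarith
    then show False
    proof cases
      case 1
      then show False using h l avoids132D[of l i x y z] low(1)[of x] low(1)[of y] low(1)[of z]
        by (simp add: av132_def)
    next
      case 2
      then show False using h low(3)[of y] mid by simp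
    next
      case 3
      then have "?p x < k" using h high(2)[of z] by simp
      then have "i < x" using low(2)[of x] mid by (cases x i rule: linorder_cases) auto
      then have "x - Suc i < y - Suc i" "y - Suc i < z - Suc i" "z - Suc i < k" using h by auto
      then show False
        using \<open>i < x\<close> h 3 r avoids132D[of r k "x - Suc i" "y - Suc i" "z - Suc i"]
          high(1)[of x] high(1)[of y] high(1)[of z] by (simp add: av132_def)
    qed
  qed
  ultimately show ?thesis by (simp add: av132_def)
qed

text \<open>With the maximum as the 3, avoidance places the \<open>i + 1\<close> largest values at
  the first \<open>i + 1\<close> positions.\<close>

lemma join_at_max_surj:
  assumes p: "p \<in> av132 (Suc (i + k))" and pi: "p i = i + k"
  obtains l r where "l \<in> av132 i" "r \<in> av132 k" "p = join_at_max i k l r"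
proof -
  have perm: "p permutes {..<Suc (i + k)}" and pav: "avoids132 p (Suc (i + k))"
    using p by (auto simp: av132_def)
  have inj: "p x = p y \<longleftrightarrow> x = y" for x y using permutes_inj[OF perm] by (simp add: inj_eq)
  have pl: "p x < Suc (i + k) \<longleftrightarrow> x < Suc (i + k)" for x using permutes_lessThan_iff[OF perm] .
  have lt: "p x < i + k" if "x < Suc (i + k)" "x \<noteq> i" for x
    using pl[of x] inj[of x i] pi that by simp
  have top: "k \<le> p x" if x: "x < Suc i" for x
  proof -
    have "Suc (i + k) - Suc i \<le> p x"
    proof (rule left_above_right_imp_top[OF perm])
      fix z assume z: "Suc i \<le> z" "z < Suc (i + k)"
      have pz: "p z < i + k" using lt z by simp
      show "p z < p x"
      proof (cases "x = i")
        case False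
        then have "\<not> p x < p z" using avoids132D[OF pav, of x i z] x z pz pi by auto
        moreover have "p x \<noteq> p z" using inj[of x z] x z by simp
        ultimately show ?thesis by simp
      qed (use pi pz in simp)
    qed
    then show ?thesis by simp
  qed
  have topiff: "k \<le> p x \<longleftrightarrow> x < Suc i" if "x < Suc (i + k)" for x
    using top_values_iff[OF perm, of "Suc i" x] top that by simp
  define l where "l x = (if x < i then p x - k else x)" for x
  define r where "r y = (if y < k then p (y + Suc i) else y)" for y
  have l1: "p x = k + l x" "l x < i" if "x < i" for x
    using that top[of x] lt[of x] by (auto simp: l_def)
  have r1: "p x = r (x - Suc i)" if "i < x" "x < Suc (i + k)" for x
    using that by (auto simp: r_def)
  have r2: "r y < k" if "y < k" for y
    using that topiff[of "y + Suc i"] by (simp add: r_def)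
  have "l permutes {..<i}"
  proof (rule bij_imp_permutes)
    have "inj_on l {..<i}" by (rule inj_onI) (metis l1(1) inj lessThan_iff)
    moreover have "l ` {..<i} \<subseteq> {..<i}" using l1(2) by auto
    ultimately show "bij_betw l {..<i} {..<i}" by (simp add: bij_betw_def endo_inj_surj)
  qed (simp add: l_def)
  moreover have "avoids132 l i"
    unfolding avoids132_def
  proof (intro notI, elim exE conjE)
    fix x y z assume h: "x < y" "y < z" "z < i" "l x < l z" "l z < l y"
    then show False using avoids132D[OF pav, of x y z] l1(1)[of x] l1(1)[of y] l1(1)[of z] by simp
  qed
  moreover have "r permutes {..<k}"
  proof (rule bij_imp_permutes)
    have "inj_on r {..<k}" by (rule inj_onI) (simp add: r_def inj)
    moreover have "r ` {..<k} \<subseteq> {..<k}" using r2 by auto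
    ultimately show "bij_betw r {..<k} {..<k}" by (simp add: bij_betw_def endo_inj_surj)
  qed (simp add: r_def)
  moreover have "avoids132 r k"
    unfolding avoids132_def
  proof (intro notI, elim exE conjE)
    fix x y z assume h: "x < y" "y < z" "z < k" "r x < r z" "r z < r y"
    then show False using avoids132D[OF pav, of "x + Suc i" "y + Suc i" "z + Suc i"]
      by (simp add: r_def)
  qed
  moreover have "p = join_at_max i k l r"
  proof
    fix x
    have "p x = x" if "Suc (i + k) \<le> x" using permutes_not_in[OF perm, of x] that by simp
    then show "p x = join_at_max i k l r x"
      using l1(1)[of x] r1[of x] pi by (auto simp: join_at_max_def)
  qed
  ultimately show thesis by (intro that) (auto simp: av132_def)
qed

lemma join_at_max_inj:
  assumes "l \<in> av132 i" "r \<in> av132 k" "l' \<in> av132 i" "r' \<in> av132 k" "join_at_max i k l r = join_at_max i k l' r'"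
  shows "l = l' \<and> r = r'"
proof -
  have p: "l permutes {..<i}" "r permutes {..<k}" "l' permutes {..<i}" "r' permutes {..<k}"
    using assms by (auto simp: av132_def)
  have eq: "join_at_max i k l r x = join_at_max i k l' r' x" for x using assms(5) by simp
  have "l x = l' x" for x
  proof (cases "x < i")
    case True
    then show ?thesis using eq[of x] by (simp add: join_at_max_def)
  next
    case False
    then show ?thesis using permutes_not_in[OF p(1), of x] permutes_not_in[OF p(3), of x] by simp
  qed
  moreover have "r y = r' y" for y
  proof (cases "y < k")
    case True
    then show ?thesis using eq[of "y + Suc i"] by (simp add: join_at_max_def)
  next
    case False
    then show ?thesis using permutes_not_in[OF p(2), of y] permutes_not_in[OF p(4), of y] by simp
  qed
  ultimately show ?thesis by auto
qed

lemma card_av132_max_at: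
  assumes "i \<le> n"
  shows "card {p \<in> av132 (Suc n). p i = n} = card (av132 i) * card (av132 (n - i))"
proof -
  define k where "k = n - i"
  have n: "n = i + k" using assms by (simp add: k_def)
  have "bij_betw (\<lambda>(l, r). join_at_max i k l r) (av132 i \<times> av132 k) {p \<in> av132 (Suc (i + k)). p i = i + k}"
    unfolding bij_betw_def
  proof (intro conjI equalityI subsetI)
    show "inj_on (\<lambda>(l, r). join_at_max i k l r) (av132 i \<times> av132 k)"
      by (auto simp: inj_on_def dest: join_at_max_inj)
  next
    fix p assume "p \<in> (\<lambda>(l, r). join_at_max i k l r) ` (av132 i \<times> av132 k)"
    then show "p \<in> {p \<in> av132 (Suc (i + k)). p i = i + k}" by (auto simp: join_at_max_in_av132) (simp add: join_at_max_def)
  next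
    fix p assume "p \<in> {p \<in> av132 (Suc (i + k)). p i = i + k}"
    then obtain l r where "l \<in> av132 i" "r \<in> av132 k" "p = join_at_max i k l r" using join_at_max_surj by blast
    then show "p \<in> (\<lambda>(l, r). join_at_max i k l r) ` (av132 i \<times> av132 k)" by auto
  qed
  then have "card (av132 i \<times> av132 k) = card {p \<in> av132 (Suc (i + k)). p i = i + k}"
    by (rule bij_betw_same_card)
  then show ?thesis unfolding k_def[symmetric] by (simp add: n card_cartesian_product)
qed

text \<open>Splitting at the position of the maximum reproduces the Catalan convolution.\<close>

lemma card_av132: "card (av132 n) = catalan n"
proof (induction n rule: less_induct)
  case (less n)
  show ?case
  proof (cases n)
    case 0
    have "av132 0 = {id}" by (auto simp: av132_def avoids132_def)
    then show ?thesis using 0 by (simp add: catalan_def)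
  next
    case (Suc k)
    have "av132 (Suc k) = (\<Union>i\<in>{0..k}. {p \<in> av132 (Suc k). p i = k})"
    proof (intro equalityI subsetI)
      fix p assume p: "p \<in> av132 (Suc k)"
      then have perm: "p permutes {..<Suc k}" by (simp add: av132_def)
      then have "k \<in> p ` {..<Suc k}" using permutes_image[OF perm] by simp
      then show "p \<in> (\<Union>i\<in>{0..k}. {p \<in> av132 (Suc k). p i = k})" using p by auto
    qed auto
    moreover have "card (\<Union>i\<in>{0..k}. {p \<in> av132 (Suc k). p i = k}) =
        (\<Sum>i=0..k. card {p \<in> av132 (Suc k). p i = k})"
    proof (rule card_UN_disjoint)
      show "\<forall>i\<in>{0..k}. \<forall>j\<in>{0..k}. i \<noteq> j \<longrightarrow>
          {p \<in> av132 (Suc k). p i = k} \<inter> {p \<in> av132 (Suc k). p j = k} = {}"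
      proof (intro ballI impI)
        fix i j :: nat assume "i \<noteq> j"
        have "False" if "p \<in> av132 (Suc k)" "p i = k" "p j = k" for p
          using that \<open>i \<noteq> j\<close> permutes_inj[of p "{..<Suc k}"] by (auto simp: av132_def dest: injD)
        then show "{p \<in> av132 (Suc k). p i = k} \<inter> {p \<in> av132 (Suc k). p j = k} = {}" by auto
      qed
    qed (auto simp: finite_av132)
    ultimately have "card (av132 (Suc k)) = (\<Sum>i=0..k. card {p \<in> av132 (Suc k). p i = k})" by simp
    also have "\<dots> = (\<Sum>i=0..k. catalan i * catalan (k - i))"
      by (rule sum.cong) (auto simp: card_av132_max_at less Suc)
    finally show ?thesis using Suc catalan_Suc by simp
  qed
qed

section \<open>Cycle type expressed through the cube\<close>

lemma cycle_of_self: "i \<in> cycle_of p i"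
proof -
  have "(p ^^ 0) i \<in> cycle_of p i" unfolding cycle_of_def by blast
  then show ?thesis by simp
qed

lemma cycle_of_step: "x \<in> cycle_of p i \<Longrightarrow> p x \<in> cycle_of p i"
proof -
  assume "x \<in> cycle_of p i"
  then obtain t where "x = (p ^^ t) i" by (auto simp: cycle_of_def)
  then have "p x = (p ^^ Suc t) i" by simp
  then show ?thesis unfolding cycle_of_def by blast
qed

lemma cycle_of_subset:
  assumes "i \<in> S" "\<And>x. x \<in> S \<Longrightarrow> p x \<in> S"
  shows "cycle_of p i \<subseteq> S"
proof -
  have "(p ^^ t) i \<in> S" for t by (induction t) (auto simp: assms)
  then show ?thesis by (auto simp: cycle_of_def)
qed

lemma cycle_of_eq_triple:
  assumes "p (p (p i)) = i"
  shows "cycle_of p i = {i, p i, p (p i)}"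
proof
  show "cycle_of p i \<subseteq> {i, p i, p (p i)}" by (rule cycle_of_subset) (use assms in auto)
  show "{i, p i, p (p i)} \<subseteq> cycle_of p i" using cycle_of_self cycle_of_step by auto
qed

text \<open>If a cycle of size 3 did not close after three steps, \<open>i\<close> and its next
  three images would be four distinct elements of it.\<close>

lemma cube_if_card_cycle_of:
  assumes inj: "inj p" and c: "card (cycle_of p i) = 1 \<or> card (cycle_of p i) = 3"
  shows "p (p (p i)) = i"
  using c
proof
  assume "card (cycle_of p i) = 1"
  then obtain a where "cycle_of p i = {a}" by (auto simp: card_1_singleton_iff)
  moreover have "i \<in> cycle_of p i" "p i \<in> cycle_of p i" using cycle_of_self cycle_of_step by auto
  ultimately show ?thesis by auto
next
  assume c3: "card (cycle_of p i) = 3"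
  show ?thesis
  proof (rule ccontr)
    assume ne: "p (p (p i)) \<noteq> i"
    have two: "p (p i) \<noteq> i"
    proof
      assume "p (p i) = i"
      then have "cycle_of p i \<subseteq> {i, p i}" by (intro cycle_of_subset) auto
      then have "card (cycle_of p i) \<le> card {i, p i}" by (intro card_mono) auto
      also have "\<dots> \<le> 2" by (simp add: card_insert_if)
      finally show False using c3 by simp
    qed
    have one: "p i \<noteq> i" using two by auto
    have "p x = p y \<longleftrightarrow> x = y" for x y using inj by (simp add: inj_eq)
    then have "card {i, p i, p (p i), p (p (p i))} = 4" using one two ne by auto
    moreover have "{i, p i, p (p i), p (p (p i))} \<subseteq> cycle_of p i"
      using cycle_of_self cycle_of_step by auto
    moreover have "finite (cycle_of p i)" using c3 card.infinite by fastforce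
    ultimately have "4 \<le> card (cycle_of p i)" using card_mono by metis
    then show False using c3 by simp
  qed
qed

lemma card_cycle_of_if_cube:
  assumes "p (p (p i)) = i"
  shows "card (cycle_of p i) = (if p i = i then 1 else 3)"
proof (cases "p i = i")
  case False
  then have "p (p i) \<noteq> i" "p (p i) \<noteq> p i" using assms by metis+
  then show ?thesis unfolding cycle_of_eq_triple[of p i, OF assms] using False by auto
qed (simp add: cycle_of_eq_triple[of p i, OF assms])

text \<open>The 1-cycles are the singletons of fixed points, and the 3-cycles partition the moved
  points.\<close>

lemma cycle_counts:
  assumes perm: "p permutes {..<n}" and cube: "\<And>x. p (p (p x)) = x"
  shows "card {c \<in> cycles_of p n. card c = 1} = n - card {x. p x \<noteq> x}"
    and "3 * card {c \<in> cycles_of p n. card c = 3} = card {x. p x \<noteq> x}"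
proof -
  have mv: "{x. p x \<noteq> x} \<subseteq> {..<n}" using permutes_not_in[OF perm] by auto
  have ce: "cycle_of p x = {x, p x, p (p x)}" for x by (rule cycle_of_eq_triple, rule cube)
  have ct: "card (cycle_of p x) = (if p x = x then 1 else 3)" for x by (rule card_cycle_of_if_cube, rule cube)
  have "{c \<in> cycles_of p n. card c = 1} = (\<lambda>i. {i}) ` ({..<n} - {x. p x \<noteq> x})"
    (is "?A = ?B")
  proof (intro equalityI subsetI)
    fix c assume "c \<in> ?A"
    then obtain i where i: "i < n" "c = cycle_of p i" "card (cycle_of p i) = 1"
      by (auto simp: cycles_of_def)
    then have fix_i: "p i = i" using ct[of i] by (cases "p i = i") simp_all
    then have "cycle_of p i = {i}" using ce[of i] by simp
    then show "c \<in> ?B" using i fix_i by blast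
  next
    fix c assume "c \<in> ?B"
    then obtain i where i: "i < n" "p i = i" "c = {i}" by blast
    then have "c = cycle_of p i" using ce[of i] by simp
    then show "c \<in> ?A" using i ct[of i] by (simp add: cycles_of_def)
  qed
  moreover have "card ?B = card ({..<n} - {x. p x \<noteq> x})" by (rule card_image) (simp add: inj_on_def)
  moreover have "card ({..<n} - {x. p x \<noteq> x}) = n - card {x. p x \<noteq> x}"
    using mv by (simp add: card_Diff_subset finite_subset)
  ultimately show "card {c \<in> cycles_of p n. card c = 1} = n - card {x. p x \<noteq> x}" by simp

  let ?C = "{c \<in> cycles_of p n. card c = 3}"
  have finC: "finite ?C" by (simp add: cycles_of_def)
  have U: "\<Union>?C = {x. p x \<noteq> x}"
  proof (intro equalityI subsetI)
    fix x assume "x \<in> \<Union>?C"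
    then obtain i where i: "x \<in> cycle_of p i" "card (cycle_of p i) = 3" by (auto simp: cycles_of_def)
    then have "p i \<noteq> i" using ct[of i] by (cases "p i = i") simp_all
    then have "p (p i) \<noteq> p i" "p (p (p i)) \<noteq> p (p i)" using cube by metis+
    moreover have "x = i \<or> x = p i \<or> x = p (p i)" using i(1) unfolding ce[of i] by simp
    ultimately show "x \<in> {x. p x \<noteq> x}" using \<open>p i \<noteq> i\<close> by (elim disjE) simp_all
  next
    fix x assume x: "x \<in> {x. p x \<noteq> x}"
    then have "card (cycle_of p x) = 3" using ct[of x] by simp
    moreover have "x < n" using x mv by auto
    ultimately have "cycle_of p x \<in> ?C" by (simp add: cycles_of_def)
    then show "x \<in> \<Union>?C" using cycle_of_self[of x p] by (rule UnionI)
  qed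
  have same: "cycle_of p x = cycle_of p i" if "x \<in> cycle_of p i" for x i
  proof -
    consider "x = i" | "x = p i" | "x = p (p i)" using \<open>x \<in> cycle_of p i\<close> unfolding ce[of i] by auto
    then show ?thesis
    proof cases
      case 2
      then have "cycle_of p x = {p i, p (p i), i}" using ce[of x] cube[of i] by simp
      then show ?thesis unfolding ce[of i] by blast
    next
      case 3
      then have "cycle_of p x = {p (p i), i, p i}" using ce[of x] cube[of i] by simp
      then show ?thesis unfolding ce[of i] by blast
    qed simp
  qed
  have "3 * card ?C = card (\<Union>?C)"
  proof (rule card_partition)
    show "finite (\<Union>?C)" unfolding U using mv finite_subset by blast
    fix c d assume cd: "c \<in> ?C" "d \<in> ?C" "c \<noteq> d"
    show "c \<inter> d = {}"
    proof (rule ccontr)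
      assume "c \<inter> d \<noteq> {}"
      then obtain x where "x \<in> c" "x \<in> d" by auto
      moreover obtain i k where "c = cycle_of p i" "d = cycle_of p k" using cd by (auto simp: cycles_of_def)
      ultimately show False using same cd(3) by metis
    qed
  qed (use finC in auto)
  then show "3 * card ?C = card {x. p x \<noteq> x}" using U by simp
qed

lemma cycle_type_set_eq_tri_perms:
  assumes n: "n = 3 * m + r"
  shows "{p. p permutes {..<n} \<and> avoids132 p n \<and>
                 (\<forall>c\<in>cycles_of p n. card c = 1 \<or> card c = 3) \<and>
                 card {c\<in>cycles_of p n. card c = 1} = r \<and>
                 card {c\<in>cycles_of p n. card c = 3} = m} = tri_perms n m"
    (is "?A = _")
proof (intro equalityI subsetI)
  fix p assume p: "p \<in> ?A"
  then have perm: "p permutes {..<n}" by simp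
  have cube: "p (p (p x)) = x" for x
  proof (cases "x < n")
    case True
    then have "cycle_of p x \<in> cycles_of p n" by (simp add: cycles_of_def)
    then show ?thesis using p permutes_inj[OF perm] by (intro cube_if_card_cycle_of) auto
  next
    case False
    then show ?thesis using permutes_not_in[OF perm, of x] by simp
  qed
  then show "p \<in> tri_perms n m" using p cycle_counts(2)[OF perm cube] by (simp add: tri_perms_def)
next
  fix p assume p: "p \<in> tri_perms n m"
  then have perm: "p permutes {..<n}" and cube: "\<And>x. p (p (p x)) = x"
    and mv: "card {x. p x \<noteq> x} = 3 * m" by (auto simp: tri_perms_def)
  have "card {c\<in>cycles_of p n. card c = 1} = r" using cycle_counts(1)[OF perm cube] mv n by simp
  moreover have "card {c\<in>cycles_of p n. card c = 3} = m" using cycle_counts(2)[OF perm cube] mv by simp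
  moreover have "\<forall>c\<in>cycles_of p n. card c = 1 \<or> card c = 3"
    using card_cycle_of_if_cube[of p] cube by (auto simp: cycles_of_def)
  ultimately show "p \<in> ?A" using p by (simp add: tri_perms_def)
qed

section \<open>Generating functions by number of 3-cycles\<close>

text \<open>The variable marks 3-cycles while the number \<open>r\<close> of fixed points is held
  constant, as it is when a block is removed.\<close>

definition tri_perms_fps :: "nat \<Rightarrow> nat \<Rightarrow> rat fps" where
  "tri_perms_fps r t = Abs_fps (\<lambda>m. of_nat (card (tri_perms_ge t (3 * m + r) m)))"

lemma tri_perms_ge_1: "tri_perms_ge 1 N m = tri_perms N m"
proof -
  have "card (sites N p) \<noteq> 0" for p
    using zero_in_sites[of N p] by (metis card_eq_0_iff empty_iff finite_sites)
  then have "1 \<le> card (sites N p)" for p by (metis Suc_leI One_nat_def gr0I)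
  then show ?thesis by (auto simp: tri_perms_ge_def)
qed

text \<open>Permutations with exactly \<open>t\<close> sites are split off; removing a block from
  them gives the convolution with \<open>c\<close>.\<close>

lemma tri_perms_fps_rec:
  assumes t: "2 \<le> t"
  shows "tri_perms_fps r t = tri_perms_fps r (Suc t) + xcat_fps * tri_perms_fps r (t - 1)"
proof (rule fps_ext)
  fix m
  let ?N = "3 * m + r"
  have "tri_perms_ge t ?N m = tri_perms_ge (Suc t) ?N m \<union> {p \<in> tri_perms ?N m. card (sites ?N p) = t}"
    by (auto simp: tri_perms_ge_def)
  moreover have "card (tri_perms_ge (Suc t) ?N m \<union> {p \<in> tri_perms ?N m. card (sites ?N p) = t})
      = card (tri_perms_ge (Suc t) ?N m) + card {p \<in> tri_perms ?N m. card (sites ?N p) = t}"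
    by (rule card_Un_disjoint) (auto simp: finite_tri_perms_ge finite_tri_perms tri_perms_ge_def)
  ultimately have "card (tri_perms_ge t ?N m) = card (tri_perms_ge (Suc t) ?N m) +
      (\<Sum>i=1..m. card (av132 (i - 1)) * card (tri_perms_ge (t - 1) (?N - 3 * i) (m - i)))"
    using card_tri_perms_sites_eq[OF t, of m ?N] by simp
  also have "(\<Sum>i=1..m. card (av132 (i - 1)) * card (tri_perms_ge (t - 1) (?N - 3 * i) (m - i)))
      = (\<Sum>i=1..m. catalan (i - 1) * card (tri_perms_ge (t - 1) (3 * (m - i) + r) (m - i)))"
  proof (rule sum.cong[OF refl])
    fix i assume "i \<in> {1..m}"
    then have "?N - 3 * i = 3 * (m - i) + r" by auto
    then show "card (av132 (i - 1)) * card (tri_perms_ge (t - 1) (?N - 3 * i) (m - i))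
      = catalan (i - 1) * card (tri_perms_ge (t - 1) (3 * (m - i) + r) (m - i))"
      by (simp only: card_av132)
  qed
  finally have "tri_perms_fps r t $ m = tri_perms_fps r (Suc t) $ m +
      (\<Sum>i=1..m. xcat_fps $ i * tri_perms_fps r (t - 1) $ (m - i))"
    by (simp add: tri_perms_fps_def xcat_fps_def catalan_fps_def)
  also have "(\<Sum>i=1..m. xcat_fps $ i * tri_perms_fps r (t - 1) $ (m - i))
      = (\<Sum>i=0..m. xcat_fps $ i * tri_perms_fps r (t - 1) $ (m - i))"
    by (rule sum.mono_neutral_left) (auto simp: not_le Suc_le_eq)
  finally show "tri_perms_fps r t $ m = (tri_perms_fps r (Suc t) + xcat_fps * tri_perms_fps r (t - 1)) $ m"
    by (simp add: fps_mult_nth)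
qed

lemma tri_perms_fps_2: "tri_perms_fps r 2 = layer_fps * tri_perms_fps r 1"
proof (rule catalan_ladder)
  show "\<exists>t0. \<forall>t\<ge>t0. \<forall>k\<le>n. tri_perms_fps r t $ k = 0" for n
  proof (intro exI allI impI)
    \<comment> \<open>There are at most \<open>3 * k + r + 1\<close> sites, so from this threshold
      on all coefficients up to \<open>n\<close> vanish.\<close>
    fix t k assume "3 * n + r + 2 \<le> t" "k \<le> n"
    then have "\<not> t \<le> card (sites (3 * k + r) p)" for p using card_sites_le[of "3 * k + r" p] by linarith
    then have "tri_perms_ge t (3 * k + r) k = {}" by (auto simp: tri_perms_ge_def)
    then show "tri_perms_fps r t $ k = 0" by (simp add: tri_perms_fps_def)
  qed
qed (rule tri_perms_fps_rec)

text \<open>The empty permutation gives the 1. For \<open>m > 0\<close> the last point cannot be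
  fixed, since \<open>3 * m\<close> moved points do not fit into \<open>3 * m - 1\<close>
  positions.\<close>

lemma tri_perms_fps_0: "tri_perms_fps 0 1 * (1 - 2 * layer_fps) = 1"
proof -
  have "tri_perms_fps 0 1 = 1 + 2 * tri_perms_fps 0 2"
  proof (rule fps_ext)
    fix m show "tri_perms_fps 0 1 $ m = (1 + 2 * tri_perms_fps 0 2) $ m"
    proof (cases m)
      case 0
      have "tri_perms 0 0 = {id}" by (auto simp: tri_perms_def avoids132_def)
      moreover have "\<not> 2 \<le> card (sites 0 p)" for p using card_sites_le[of 0 p] by simp
      then have "tri_perms_ge 2 0 0 = {}" by (simp add: tri_perms_ge_def)
      ultimately show ?thesis using 0 by (simp add: tri_perms_fps_def tri_perms_ge_1[unfolded One_nat_def] numeral_fps_const)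
    next
      case (Suc k)
      have N: "3 * m = Suc (3 * k + 2)" using Suc by simp
      have "tri_perms (3 * k + 2) m = {}"
      proof (rule equals0I)
        fix p assume "p \<in> tri_perms (3 * k + 2) m"
        then have perm: "p permutes {..<3 * k + 2}" and c: "card {x. p x \<noteq> x} = 3 * m" by (auto simp: tri_perms_def)
        have "{x. p x \<noteq> x} \<subseteq> {..<3 * k + 2}" using permutes_not_in[OF perm] by auto
        then have "card {x. p x \<noteq> x} \<le> card {..<3 * k + 2}" by (intro card_mono) auto
        then show False using c N by simp
      qed
      then have "card (tri_perms (3 * m) m) = 2 * card (tri_perms_ge 2 (3 * m) m)"
        unfolding N card_tri_perms_Suc by simp
      then show ?thesis using Suc by (simp add: tri_perms_fps_def tri_perms_ge_1[unfolded One_nat_def] numeral_fps_const)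
    qed
  qed
  then have "tri_perms_fps 0 1 - 2 * tri_perms_fps 0 2 = 1" by simp
  then show ?thesis unfolding tri_perms_fps_2 by (simp add: algebra_simps)
qed

text \<open>Dropping a fixed last point lowers \<open>r\<close> by one; the two other classes each
  contribute \<open>G\<close> times the series.\<close>

lemma tri_perms_fps_Suc: "tri_perms_fps (Suc r) 1 * (1 - 2 * layer_fps) = tri_perms_fps r 1"
proof -
  have "tri_perms_fps (Suc r) 1 = tri_perms_fps r 1 + 2 * tri_perms_fps (Suc r) 2"
  proof (rule fps_ext)
    fix m show "tri_perms_fps (Suc r) 1 $ m = (tri_perms_fps r 1 + 2 * tri_perms_fps (Suc r) 2) $ m"
      using card_tri_perms_Suc[of "3 * m + r" m] by (simp add: tri_perms_fps_def tri_perms_ge_1[unfolded One_nat_def] numeral_fps_const)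
  qed
  then have "tri_perms_fps (Suc r) 1 - 2 * tri_perms_fps (Suc r) 2 = tri_perms_fps r 1" by simp
  then show ?thesis unfolding tri_perms_fps_2 by (simp add: algebra_simps)
qed

theorem theorem4p8:
  fixes m r n :: nat
  assumes "m \<ge> 3" and "n = 3 * m + r"
  shows "card {p. p permutes {..<n} \<and> avoids132 p n \<and>
                 (\<forall>c\<in>cycles_of p n. card c = 1 \<or> card c = 3) \<and>
                 card {c\<in>cycles_of p n. card c = 1} = r \<and>
                 card {c\<in>cycles_of p n. card c = 3} = m}
       = (\<Sum>k=1..m. \<Sum>l=2..k+1.
            2 ^ (l - 1) * ((r + l - 1) choose r) * motzkin_M (k - 1) (l - 2) *
            (\<Sum>xs\<in>compositions m k. prod_list (map catalan xs)))"
proof -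
  have "tri_perms_fps r 1 = neg_binomial_fps r oo (2 * layer_fps)"
    by (rule series_solution[where T = "\<lambda>r. tri_perms_fps r 1", OF tri_perms_fps_0 tri_perms_fps_Suc])
  moreover have "tri_perms_fps r 1 $ m = of_nat (card (tri_perms n m))"
    unfolding tri_perms_fps_def tri_perms_ge_1 assms(2) by simp
  ultimately have "rat_of_nat (card (tri_perms n m)) = (neg_binomial_fps r oo (2 * layer_fps)) $ m" by simp
  also have "\<dots> = of_nat (\<Sum>k=1..m. \<Sum>l=2..k+1.
            2 ^ (l - 1) * ((r + l - 1) choose r) * motzkin_M (k - 1) (l - 2) *
            (\<Sum>xs\<in>compositions m k. prod_list (map catalan xs)))"
    by (rule formula_eq_nth_compose[symmetric]) (use assms in simp)
  finally show ?thesis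
    unfolding cycle_type_set_eq_tri_perms[OF assms(2)] by (simp only: of_nat_eq_iff)
qed

end
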